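(* Fix an integer $k\ge1$ and constants $\sigma_a,\sigma_z>0$. Let $\mathbf{W}$ be a random vector in $\mathbb{R}^k$ with nonzero entries whose distribution has bounded support, and let $(n_m)_{m\ge k}$ be a sequence of positive integers with $\limsup_{m\to\infty}\frac{\log m}{n_m}=r$. Let $A^{(m)}\in\mathbb{R}^{n_m\times m}$ be a random matrix with i.i.d. entries $A^{(m)}_{ij}\sim\mathcal{N}(0,\sigma_a^2)$. Then there exists a sequence of support recovery maps $\{d^{(m)}\}_{m=k}^\infty$, $d^{(m)}:\mathbb{R}^{n_m}\to2^{[m]}$ (where $d^{(m)}$ may depend on the realization of $A^{(m)}$, but not on that of $\mathbf{W}$), such that $$\limsup_{m\to\infty}\mathsf{P}\left\{d^{(m)}\big(A^{(m)}\mathbf{X}(\mathbf{W},\mathbf{S})+\mathbf{Z}\big)\neq\mathrm{supp}(\mathbf{X}(\mathbf{W},\mathbf{S}))\right\}\le\mathsf{P}\{c(\mathbf{W})\le r\},$$ where for $\mathbf{w}\in\mathbb{R}^k$ $$c(\mathbf{w})=\min_{\emptyset\neq\mathcal{T}\subseteq[k]}\left[\frac{1}{2|\mathcal{T}|}\log\left(1+\frac{\sigma_a^2}{\sigma_z^2}\sum_{j\in\mathcal{T}}w_j^2\right)\right].$$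
   Context: Notation: $[m]=\{1,\dots,m\}$, $2^{[m]}$ is the set of subsets of $[m]$. The base of $\log$ is the same everywhere (and is then immaterial). For each $m\ge k$, $\mathbf{S}=(S_1,\dots,S_k)$ is chosen uniformly at random from $[m]$ without replacement (uniform over ordered $k$-tuples of distinct elements). For $\mathbf{w}\in\mathbb{R}^k$ with nonzero entries, the signal $\mathbf{X}=\mathbf{X}(\mathbf{w},\mathbf{S})\in\mathbb{R}^m$ has $X_s=w_j$ if $s=S_j$, and $X_s=0$ if $s\notin\{S_1,\dots,S_k\}$; so $\mathrm{supp}(\mathbf{X})=\{S_1,\dots,S_k\}$. The noise $\mathbf{Z}\in\mathbb{R}^{n_m}$ has i.i.d. $\mathcal{N}(0,\sigma_z^2)$ entries. $\mathbf{W}$ (whose law does not depend on $m$), $A^{(m)}$, $\mathbf{S}$ and $\mathbf{Z}$ are mutually independent, and the probability is over all of them. A support recovery map produces an estimate of the support from the measurement vector; the measurement matrix is known to the decoder, so formally the estimate is a measurable function of the pair (measurement vector, $A^{(m)}$). *)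

theory Defs
  imports "HOL-Probability.Probability"
begin

text \<open>Vectors in \<open>\<real>\<^sup>n\<close> are functions \<open>nat \<Rightarrow> real\<close> used on the index set \<open>{1..n}\<close>, and
  \<open>n \<times> m\<close> matrices are functions on \<open>{1..n} \<times> {1..m}\<close>; both are measured with the
  product Borel sigma-algebra.\<close>

definition gaussian :: "real \<Rightarrow> real measure" where
  "gaussian \<sigma> = density lborel (\<lambda>x. ennreal (normal_density 0 \<sigma> x))"

definition gaussian_vector :: "real \<Rightarrow> nat \<Rightarrow> (nat \<Rightarrow> real) measure" where
  "gaussian_vector \<sigma> n = (\<Pi>\<^sub>M i\<in>{1..n}. gaussian \<sigma>)"

definition gaussian_matrix :: "real \<Rightarrow> nat \<Rightarrow> nat \<Rightarrow> (nat \<times> nat \<Rightarrow> real) measure" where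
  "gaussian_matrix \<sigma> n m = (\<Pi>\<^sub>M ij\<in>{1..n} \<times> {1..m}. gaussian \<sigma>)"

definition distinct_tuples :: "nat \<Rightarrow> nat \<Rightarrow> (nat \<Rightarrow> nat) set" where
  "distinct_tuples k m = {s \<in> {1..k} \<rightarrow>\<^sub>E {1..m}. inj_on s {1..k}}"

text \<open>The joint law of \<open>(W, A, S, Z)\<close>, where \<open>\<mu>\<close> is the law of \<open>W\<close>. Mutual independence of
  the four components is expressed by taking the product of their laws.\<close>

definition joint_law :: "nat \<Rightarrow> nat \<Rightarrow> nat \<Rightarrow> (nat \<Rightarrow> real) measure \<Rightarrow> real \<Rightarrow> real \<Rightarrow>
    ((nat \<Rightarrow> real) \<times> (nat \<times> nat \<Rightarrow> real) \<times> (nat \<Rightarrow> nat) \<times> (nat \<Rightarrow> real)) measure" where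
  "joint_law k m n \<mu> \<sigma>\<^sub>a \<sigma>\<^sub>z =
     \<mu> \<Otimes>\<^sub>M gaussian_matrix \<sigma>\<^sub>a n m \<Otimes>\<^sub>M uniform_count_measure (distinct_tuples k m)
       \<Otimes>\<^sub>M gaussian_vector \<sigma>\<^sub>z n"

definition signal :: "nat \<Rightarrow> (nat \<Rightarrow> real) \<Rightarrow> (nat \<Rightarrow> nat) \<Rightarrow> nat \<Rightarrow> real" where
  "signal k w s = (\<lambda>i. if i \<in> s ` {1..k} then w (the_inv_into {1..k} s i) else 0)"

definition supp :: "nat \<Rightarrow> (nat \<Rightarrow> real) \<Rightarrow> nat set" where
  "supp m x = {i \<in> {1..m}. x i \<noteq> 0}"

definition measurement ::
    "nat \<Rightarrow> nat \<Rightarrow> (nat \<times> nat \<Rightarrow> real) \<Rightarrow> (nat \<Rightarrow> real) \<Rightarrow> (nat \<Rightarrow> real) \<Rightarrow> nat \<Rightarrow> real" where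
  "measurement n m A x z = (\<lambda>i\<in>{1..n}. (\<Sum>j\<in>{1..m}. A (i, j) * x j) + z i)"

text \<open>The decoder sees the measurement vector and the measurement matrix.\<close>

definition recovery_maps ::
    "nat \<Rightarrow> nat \<Rightarrow> ((nat \<Rightarrow> real) \<times> (nat \<times> nat \<Rightarrow> real) \<Rightarrow> nat set) set" where
  "recovery_maps n m =
     (\<Pi>\<^sub>M i\<in>{1..n}. borel) \<Otimes>\<^sub>M (\<Pi>\<^sub>M ij\<in>{1..n} \<times> {1..m}. borel)
       \<rightarrow>\<^sub>M count_space (Pow {1..m})"

definition capacity :: "real \<Rightarrow> nat \<Rightarrow> real \<Rightarrow> real \<Rightarrow> (nat \<Rightarrow> real) \<Rightarrow> real" where
  "capacity b k \<sigma>\<^sub>a \<sigma>\<^sub>z w =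
     Min ((\<lambda>T. 1 / (2 * real (card T)) * log b (1 + \<sigma>\<^sub>a\<^sup>2 / \<sigma>\<^sub>z\<^sup>2 * (\<Sum>j\<in>T. (w j)\<^sup>2)))
            ` {T. T \<noteq> {} \<and> T \<subseteq> {1..k}})"

end

theory Submission
  imports Defs "HOL-Real_Asymp.Real_Asymp"
begin

text \<open>The decoder quantizes: it minimizes the residual over all \<open>k\<close>-sparse signals whose nonzero
  entries lie in a grid of spacing \<open>2 / n\<close>, and outputs the support of a minimizer. Suppose a
  candidate misses the \<open>t\<close> true positions in \<open>D\<close>. There are about \<open>m ^ t\<close> such candidates, up to a
  factor polynomial in \<open>n\<close>. Split the residual of the candidate into a part \<open>U\<close> free of the wrongly
  chosen columns, and the contribution \<open>V\<close> of these columns. Up to polynomially many choices \<open>U\<close>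
  does not depend on the candidate, and its energy is at least about
  \<open>n * \<tau> = n * (\<sigma>\<^sub>z\<^sup>2 + \<sigma>\<^sub>a\<^sup>2 * (\<Sum>j\<in>D. (x j)\<^sup>2))\<close>. Given \<open>U\<close>, the probability that \<open>U - V\<close> has energy
  at most \<open>n * \<rho>\<close> with \<open>\<rho>\<close> near \<open>\<sigma>\<^sub>z\<^sup>2\<close> is at most \<open>(\<rho> / \<tau>) powr (n / 2)\<close>, by an exponential
  moment bound that is uniform in the variance of \<open>V\<close>. Hence the union bound
  succeeds when \<open>ln m / n\<close> is below \<open>ln (\<tau> / \<rho>) / (2 * t)\<close>, which gives the capacity. The law
  of \<open>W\<close> enters only through dominated convergence over the fixed values \<open>w\<close>.\<close>

section \<open>Gaussian integrals\<close>

lemma prob_space_gaussian: "\<sigma> > 0 \<Longrightarrow> prob_space (gaussian \<sigma>)"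
  unfolding gaussian_def by (rule prob_space_normal_density)

lemma sets_gaussian [simp, measurable_cong]: "sets (gaussian \<sigma>) = sets borel"
  by (simp add: gaussian_def)

lemma product_sigma_finite_gaussian: "\<sigma> > 0 \<Longrightarrow> product_sigma_finite (\<lambda>_. gaussian \<sigma>)"
  by (simp add: prob_space_gaussian product_sigma_finite_def prob_space_imp_sigma_finite)

text \<open>Completing the square: multiplying the normal density by the exponential gives, up to a
  constant, another normal density, whose total mass is 1. The parameter \<open>a\<close> may be
  negative as long as \<open>q > 0\<close>; upper tails rely on this.\<close>

lemma nn_integral_gaussian_exp_square:
  fixes a c u \<sigma> :: real
  defines "q \<equiv> 1 + 2 * a * \<sigma>\<^sup>2 * c\<^sup>2"
  assumes "\<sigma> > 0" "q > 0"
  shows "(\<integral>\<^sup>+x. ennreal (exp (- a * (u + c * x)\<^sup>2)) \<partial>gaussian \<sigma>) =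
    ennreal (1 / sqrt q * exp (- (a / q) * u\<^sup>2))"
proof -
  \<comment> \<open>The mean and the standard deviation of the tilted density, read off from the
    completed square.\<close>
  define \<nu> where "\<nu> = - 2 * a * u * c * \<sigma>\<^sup>2 / q"
  define \<tau> where "\<tau> = \<sigma> / sqrt q"
  have \<tau>: "\<tau> > 0" "\<tau>\<^sup>2 = \<sigma>\<^sup>2 / q"
    using assms by (simp_all add: \<tau>_def power_divide)
  have ex: "- (x - 0)\<^sup>2 / (2 * \<sigma>\<^sup>2) + - a * (u + c * x)\<^sup>2 = - (a / q) * u\<^sup>2 + - (x - \<nu>)\<^sup>2 / (2 * \<tau>\<^sup>2)" for x
  proof -
    have "2 * \<sigma>\<^sup>2 * q * (- (x - 0)\<^sup>2 / (2 * \<sigma>\<^sup>2) + - a * (u + c * x)\<^sup>2)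
       = - q * x\<^sup>2 - 2 * \<sigma>\<^sup>2 * q * a * (u + c * x)\<^sup>2"
      using assms(2,3) by (simp add: field_simps)
    also have "\<dots> = - 2 * \<sigma>\<^sup>2 * a * u\<^sup>2 - (q * x + 2 * a * u * c * \<sigma>\<^sup>2)\<^sup>2"
      unfolding q_def by algebra
    also have "(q * x + 2 * a * u * c * \<sigma>\<^sup>2) = q * (x - \<nu>)"
      using assms(3) by (simp add: \<nu>_def field_simps)
    also have "- 2 * \<sigma>\<^sup>2 * a * u\<^sup>2 - (q * (x - \<nu>))\<^sup>2
       = 2 * \<sigma>\<^sup>2 * q * (- (a / q) * u\<^sup>2 + - (x - \<nu>)\<^sup>2 / (2 * \<tau>\<^sup>2))"
      unfolding \<tau>(2) using assms(2,3) by (simp add: field_simps power2_eq_square)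
    finally show ?thesis
      using assms(2,3) by simp
  qed
  have pre: "1 / sqrt (2 * pi * \<sigma>\<^sup>2) = 1 / sqrt q * (1 / sqrt (2 * pi * \<tau>\<^sup>2))"
    using assms(2,3) by (simp add: \<tau>(2) real_sqrt_mult real_sqrt_divide)
  have "normal_density 0 \<sigma> x * exp (- a * (u + c * x)\<^sup>2)
      = 1 / sqrt q * exp (- (a / q) * u\<^sup>2) * normal_density \<nu> \<tau> x" for x
  proof -
    have "normal_density 0 \<sigma> x * exp (- a * (u + c * x)\<^sup>2) =
        1 / sqrt (2 * pi * \<sigma>\<^sup>2) * exp (- (x - 0)\<^sup>2 / (2 * \<sigma>\<^sup>2) + - a * (u + c * x)\<^sup>2)"
      by (simp only: normal_density_def exp_add mult.assoc)
    also have "\<dots> = 1 / sqrt q * (1 / sqrt (2 * pi * \<tau>\<^sup>2)) *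
        (exp (- (a / q) * u\<^sup>2) * exp (- (x - \<nu>)\<^sup>2 / (2 * \<tau>\<^sup>2)))"
      by (simp only: ex pre exp_add)
    finally show ?thesis
      by (simp only: normal_density_def mult_ac)
  qed
  then have "(\<integral>\<^sup>+x. ennreal (exp (- a * (u + c * x)\<^sup>2)) \<partial>gaussian \<sigma>) =
    (\<integral>\<^sup>+x. ennreal (1 / sqrt q * exp (- (a / q) * u\<^sup>2)) * ennreal (normal_density \<nu> \<tau> x) \<partial>lborel)"
    unfolding gaussian_def using assms(3)
    by (subst nn_integral_density) (auto simp flip: ennreal_mult intro!: nn_integral_cong)
  also have "\<dots> = ennreal (1 / sqrt q * exp (- (a / q) * u\<^sup>2))"
    using \<tau>(1) by (simp add: nn_integral_cmult nn_integral_eq_integral)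
  finally show ?thesis .
qed

lemma nn_integral_gaussian_column:
  fixes a c \<sigma> :: real and u :: "'i \<Rightarrow> real"
  defines "q \<equiv> 1 + 2 * a * \<sigma>\<^sup>2 * c\<^sup>2"
  assumes "finite K" "\<sigma> > 0" "q > 0"
  shows "(\<integral>\<^sup>+x. ennreal (exp (- a * (\<Sum>i\<in>K. (u i + c * x i)\<^sup>2))) \<partial>(\<Pi>\<^sub>M i\<in>K. gaussian \<sigma>)) =
    ennreal ((1 / sqrt q) ^ card K * exp (- (a / q) * (\<Sum>i\<in>K. (u i)\<^sup>2)))"
proof -
  interpret product_sigma_finite "\<lambda>_::'i. gaussian \<sigma>"
    using assms product_sigma_finite_gaussian by blast
  have "(\<integral>\<^sup>+x. ennreal (exp (- a * (\<Sum>i\<in>K. (u i + c * x i)\<^sup>2))) \<partial>(\<Pi>\<^sub>M i\<in>K. gaussian \<sigma>)) =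
    (\<integral>\<^sup>+x. (\<Prod>i\<in>K. ennreal (exp (- a * (u i + c * x i)\<^sup>2))) \<partial>(\<Pi>\<^sub>M i\<in>K. gaussian \<sigma>))"
    by (simp only: sum_distrib_left exp_sum[OF \<open>finite K\<close>] prod_ennreal exp_ge_zero)
  also have "\<dots> = (\<Prod>i\<in>K. ennreal (1 / sqrt q * exp (- (a / q) * (u i)\<^sup>2)))"
    by (subst product_nn_integral_prod[OF \<open>finite K\<close>])
      (auto intro!: prod.cong simp only: q_def nn_integral_gaussian_exp_square[OF assms(3) assms(4)[unfolded q_def]],
       measurable)
  also have "\<dots> = ennreal ((1 / sqrt q) ^ card K * exp (- (a / q) * (\<Sum>i\<in>K. (u i)\<^sup>2)))"
    using assms(4)
    by (subst prod_ennreal)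
      (simp_all only: prod.distrib prod_constant sum_distrib_left exp_sum[OF \<open>finite K\<close>], simp)
  finally show ?thesis .
qed

text \<open>Integrating out one column turns the parameter \<open>a\<close> into
  \<open>a / q1\<close> and produces a power of \<open>1 / sqrt q1\<close>, so the induction keeps
  \<open>a\<close> arbitrary. The factors combine because \<open>q1 * q2\<close> is the
  \<open>q\<close> of all columns together.\<close>

lemma nn_integral_gaussian_matrix:
  fixes a \<sigma> :: real and u :: "'i \<Rightarrow> real" and c :: "'j \<Rightarrow> real"
  assumes "finite I" "finite J" "\<sigma> > 0" "1 + 2 * a * \<sigma>\<^sup>2 * (\<Sum>j\<in>J. (c j)\<^sup>2) > 0"
  shows "(\<integral>\<^sup>+A. ennreal (exp (- a * (\<Sum>i\<in>I. (u i + (\<Sum>j\<in>J. c j * A (i, j)))\<^sup>2)))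
      \<partial>(\<Pi>\<^sub>M ij\<in>I \<times> J. gaussian \<sigma>)) =
    ennreal ((1 / sqrt (1 + 2 * a * \<sigma>\<^sup>2 * (\<Sum>j\<in>J. (c j)\<^sup>2))) ^ card I *
      exp (- (a / (1 + 2 * a * \<sigma>\<^sup>2 * (\<Sum>j\<in>J. (c j)\<^sup>2))) * (\<Sum>i\<in>I. (u i)\<^sup>2)))"
  using assms(2,4)
proof (induction J arbitrary: a rule: finite_induct)
  case empty
  interpret P: prob_space "PiM {} (\<lambda>_::'i \<times> 'j. gaussian \<sigma>)"
    by (rule prob_space_PiM) (use assms prob_space_gaussian in auto)
  show ?case
    using P.emeasure_space_1 by simp
next
  case (insert j J)
  interpret product_sigma_finite "\<lambda>_::'i \<times> 'j. gaussian \<sigma>"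
    using assms product_sigma_finite_gaussian by blast
  define C where "C = (\<Sum>j\<in>J. (c j)\<^sup>2)"
  define q1 where "q1 = 1 + 2 * a * \<sigma>\<^sup>2 * (c j)\<^sup>2"
  have C: "C \<ge> 0" by (simp add: C_def sum_nonneg)
  have q: "q1 + 2 * a * \<sigma>\<^sup>2 * C > 0"
    using insert by (simp add: q1_def C_def algebra_simps)
  have q1: "q1 > 0"
  proof (cases "a \<ge> 0")
    case True
    then show ?thesis by (auto simp: q1_def intro!: add_pos_nonneg)
  next
    \<comment> \<open>For negative \<open>a\<close>, dropping the columns of \<open>J\<close> can
      only increase \<open>q\<close>, so positivity passes to \<open>q1\<close>.\<close>
    case False
    then have "2 * a * \<sigma>\<^sup>2 \<le> 0"
      by (simp add: mult_nonpos_nonneg)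
    then have "2 * a * \<sigma>\<^sup>2 * C \<le> 0"
      using C by (rule mult_nonpos_nonneg)
    then show ?thesis using q by linarith
  qed
  define q2 where "q2 = 1 + 2 * (a / q1) * \<sigma>\<^sup>2 * C"
  have qq: "q1 * q2 = 1 + 2 * a * \<sigma>\<^sup>2 * (\<Sum>j\<in>insert j J. (c j)\<^sup>2)"
    using insert q1 by (simp add: q2_def C_def[symmetric] field_simps) (simp add: q1_def algebra_simps)
  have q2: "q2 > 0"
    using qq insert.prems q1 by (metis zero_less_mult_pos)
  have split: "I \<times> insert j J = (I \<times> J) \<union> (I \<times> {j})" by auto
  define F where "F = (\<lambda>A. ennreal (exp (- a * (\<Sum>i\<in>I. (u i + (\<Sum>j\<in>insert j J. c j * A (i, j)))\<^sup>2))))"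
  have F: "F \<in> borel_measurable (PiM (I \<times> J \<union> I \<times> {j}) (\<lambda>_. gaussian \<sigma>))"
    unfolding F_def split[symmetric] by measurable
  have "(\<integral>\<^sup>+A. F A \<partial>(\<Pi>\<^sub>M ij\<in>I \<times> insert j J. gaussian \<sigma>)) =
    (\<integral>\<^sup>+x. (\<integral>\<^sup>+y. F (merge (I \<times> J) (I \<times> {j}) (x, y)) \<partial>(\<Pi>\<^sub>M ij\<in>I \<times> {j}. gaussian \<sigma>))
      \<partial>(\<Pi>\<^sub>M ij\<in>I \<times> J. gaussian \<sigma>))"
    unfolding split using insert \<open>finite I\<close>
    by (intro product_nn_integral_fold F) auto
  also have "\<dots> = (\<integral>\<^sup>+x. (\<integral>\<^sup>+y. ennreal (exp (- a * (\<Sum>p\<in>I \<times> {j}.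
      ((u (fst p) + (\<Sum>j\<in>J. c j * x (fst p, j))) + c j * y p)\<^sup>2))) \<partial>(\<Pi>\<^sub>M ij\<in>I \<times> {j}. gaussian \<sigma>))
      \<partial>(\<Pi>\<^sub>M ij\<in>I \<times> J. gaussian \<sigma>))"
  proof (intro nn_integral_cong)
    fix x y :: "'i \<times> 'j \<Rightarrow> real"
    have "(\<Sum>i\<in>I. (u i + (\<Sum>l\<in>insert j J. c l * merge (I \<times> J) (I \<times> {j}) (x, y) (i, l)))\<^sup>2) =
      (\<Sum>i\<in>I. ((u i + (\<Sum>j\<in>J. c j * x (i, j))) + c j * y (i, j))\<^sup>2)"
    proof (rule sum.cong)
      fix i assume i: "i \<in> I"
      have "(\<Sum>l\<in>J. c l * merge (I \<times> J) (I \<times> {j}) (x, y) (i, l)) = (\<Sum>l\<in>J. c l * x (i, l))"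
        using i by (intro sum.cong) (auto simp: merge_def)
      then show "(u i + (\<Sum>l\<in>insert j J. c l * merge (I \<times> J) (I \<times> {j}) (x, y) (i, l)))\<^sup>2 =
          ((u i + (\<Sum>j\<in>J. c j * x (i, j))) + c j * y (i, j))\<^sup>2"
        using insert i by (simp add: add_ac) (simp add: merge_def add_ac)
    qed simp
    also have "\<dots> = (\<Sum>p\<in>I \<times> {j}. ((u (fst p) + (\<Sum>j\<in>J. c j * x (fst p, j))) + c j * y p)\<^sup>2)"
      by (rule sum.reindex_bij_witness[where i = fst and j = "\<lambda>i. (i, j)"]) auto
    finally show "F (merge (I \<times> J) (I \<times> {j}) (x, y)) = ennreal (exp (- a * (\<Sum>p\<in>I \<times> {j}.
      ((u (fst p) + (\<Sum>j\<in>J. c j * x (fst p, j))) + c j * y p)\<^sup>2)))"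
      by (simp only: F_def)
  qed
  also have "\<dots> = (\<integral>\<^sup>+x. ennreal ((1 / sqrt q1) ^ card I) * ennreal (exp (- (a / q1) * (\<Sum>i\<in>I.
      (u i + (\<Sum>j\<in>J. c j * x (i, j)))\<^sup>2))) \<partial>(\<Pi>\<^sub>M ij\<in>I \<times> J. gaussian \<sigma>))"
  proof (intro nn_integral_cong)
    fix x :: "'i \<times> 'j \<Rightarrow> real"
    have s: "(\<Sum>p\<in>I \<times> {j}. (u (fst p) + (\<Sum>j\<in>J. c j * x (fst p, j)))\<^sup>2) =
      (\<Sum>i\<in>I. (u i + (\<Sum>j\<in>J. c j * x (i, j)))\<^sup>2)"
      by (rule sum.reindex_bij_witness[where j = fst and i = "\<lambda>i. (i, j)"]) auto
    show "(\<integral>\<^sup>+y. ennreal (exp (- a * (\<Sum>p\<in>I \<times> {j}.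
      ((u (fst p) + (\<Sum>j\<in>J. c j * x (fst p, j))) + c j * y p)\<^sup>2))) \<partial>(\<Pi>\<^sub>M ij\<in>I \<times> {j}. gaussian \<sigma>)) =
      ennreal ((1 / sqrt q1) ^ card I) * ennreal (exp (- (a / q1) * (\<Sum>i\<in>I.
      (u i + (\<Sum>j\<in>J. c j * x (i, j)))\<^sup>2)))"
      using \<open>finite I\<close> q1 assms(3)
      by (subst nn_integral_gaussian_column)
        (simp_all add: q1_def[symmetric] s ennreal_mult card_cartesian_product)
  qed
  also have "\<dots> = ennreal ((1 / sqrt q1) ^ card I) * (\<integral>\<^sup>+x. ennreal (exp (- (a / q1) * (\<Sum>i\<in>I.
      (u i + (\<Sum>j\<in>J. c j * x (i, j)))\<^sup>2))) \<partial>(\<Pi>\<^sub>M ij\<in>I \<times> J. gaussian \<sigma>))"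
    by (rule nn_integral_cmult) measurable
  also have "\<dots> = ennreal ((1 / sqrt q1) ^ card I) * ennreal ((1 / sqrt q2) ^ card I *
      exp (- ((a / q1) / q2) * (\<Sum>i\<in>I. (u i)\<^sup>2)))"
    using q2 by (subst insert.IH) (simp_all add: q2_def C_def)
  also have "\<dots> = ennreal ((1 / sqrt (q1 * q2)) ^ card I * exp (- (a / (q1 * q2)) * (\<Sum>i\<in>I. (u i)\<^sup>2)))"
    using q1 q2 by (subst ennreal_mult[symmetric])
      (simp_all add: power_mult_distrib real_sqrt_mult power_divide divide_simps)
  finally show ?case
    unfolding qq F_def .
qed

section \<open>Squared norms of noisy combinations of columns\<close>

text \<open>This is the squared norm of \<open>z + A c\<close>; for \<open>c = x - y\<close> it is
  the residual of the candidate \<open>y\<close>. The coordinates of \<open>z + A c\<close> are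
  independent centred Gaussians of variance \<open>\<sigma>\<^sub>z\<^sup>2 +
  \<sigma>\<^sub>a\<^sup>2 * (\<Sum>j\<in>{1..m}. (c j)\<^sup>2)\<close>.\<close>

definition energy :: "nat \<Rightarrow> nat \<Rightarrow> (nat \<times> nat \<Rightarrow> real) \<Rightarrow> (nat \<Rightarrow> real) \<Rightarrow> (nat \<Rightarrow> real) \<Rightarrow> real" where
  "energy n m A z c = (\<Sum>i\<in>{1..n}. (z i + (\<Sum>j\<in>{1..m}. c j * A (i, j)))\<^sup>2)"

abbreviation noise_law :: "real \<Rightarrow> real \<Rightarrow> nat \<Rightarrow> nat \<Rightarrow> ((nat \<times> nat \<Rightarrow> real) \<times> (nat \<Rightarrow> real)) measure" where
  "noise_law \<sigma>\<^sub>a \<sigma>\<^sub>z n m \<equiv> gaussian_matrix \<sigma>\<^sub>a n m \<Otimes>\<^sub>M gaussian_vector \<sigma>\<^sub>z n"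

lemma sets_gaussian_matrix [measurable_cong]:
  "sets (gaussian_matrix \<sigma> n m) = sets (\<Pi>\<^sub>M ij\<in>{1..n} \<times> {1..m}. borel)"
  unfolding gaussian_matrix_def by (intro sets_PiM_cong) auto

lemma sets_gaussian_vector [measurable_cong]:
  "sets (gaussian_vector \<sigma> n) = sets (\<Pi>\<^sub>M i\<in>{1..n}. borel)"
  unfolding gaussian_vector_def by (intro sets_PiM_cong) auto

lemma prob_space_gaussian_matrix: "\<sigma> > 0 \<Longrightarrow> prob_space (gaussian_matrix \<sigma> n m)"
  unfolding gaussian_matrix_def by (intro prob_space_PiM prob_space_gaussian)

lemma prob_space_gaussian_vector: "\<sigma> > 0 \<Longrightarrow> prob_space (gaussian_vector \<sigma> n)"
  unfolding gaussian_vector_def by (intro prob_space_PiM prob_space_gaussian)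

lemma pair_sigma_finite_noise:
  "\<sigma>\<^sub>a > 0 \<Longrightarrow> \<sigma>\<^sub>z > 0 \<Longrightarrow> pair_sigma_finite (gaussian_matrix \<sigma>\<^sub>a n m) (gaussian_vector \<sigma>\<^sub>z n)"
  by (simp add: pair_sigma_finite_def prob_space_imp_sigma_finite prob_space_gaussian_matrix
      prob_space_gaussian_vector)

lemma measurable_gaussian_matrix_entry:
  "i \<in> {1..n} \<Longrightarrow> j \<in> {1..m} \<Longrightarrow> (\<lambda>A. A (i, j)) \<in> borel_measurable (gaussian_matrix \<sigma> n m)"
  unfolding measurable_cong_sets[OF sets_gaussian_matrix refl]
  by (rule measurable_component_singleton) auto

lemma measurable_gaussian_vector_entry:
  "i \<in> {1..n} \<Longrightarrow> (\<lambda>z. z i) \<in> borel_measurable (gaussian_vector \<sigma> n)"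
  unfolding measurable_cong_sets[OF sets_gaussian_vector refl]
  by (rule measurable_component_singleton) auto

lemma measurable_energy [measurable]:
  assumes [measurable]: "f \<in> N \<rightarrow>\<^sub>M gaussian_matrix \<sigma>\<^sub>a n m" "g \<in> N \<rightarrow>\<^sub>M gaussian_vector \<sigma>\<^sub>z n"
  shows "(\<lambda>x. energy n m (f x) (g x) c) \<in> borel_measurable N"
  unfolding energy_def
  by (intro borel_measurable_sum borel_measurable_power borel_measurable_add borel_measurable_times
      measurable_const UNIV_I measurable_compose[OF assms(1) measurable_gaussian_matrix_entry]
      measurable_compose[OF assms(2) measurable_gaussian_vector_entry]) auto

lemma measurable_energy_fst:
  "(\<lambda>A. energy n m A z c) \<in> borel_measurable (gaussian_matrix \<sigma>\<^sub>a n m)"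
  unfolding energy_def by measurable

text \<open>The noise acts like one more column with coefficient 1, so integrating first over
  \<open>A\<close> and then over \<open>z\<close> multiplies \<open>q1\<close> and \<open>q2\<close>
  to \<open>q\<close>. The result is the Laplace transform of a scaled chi-square variable with
  \<open>n\<close> degrees of freedom.\<close>

lemma nn_integral_exp_energy:
  fixes a \<sigma>\<^sub>a \<sigma>\<^sub>z :: real and n m :: nat and c :: "nat \<Rightarrow> real"
  defines "q \<equiv> 1 + 2 * a * (\<sigma>\<^sub>z\<^sup>2 + \<sigma>\<^sub>a\<^sup>2 * (\<Sum>j\<in>{1..m}. (c j)\<^sup>2))"
  assumes "\<sigma>\<^sub>a > 0" "\<sigma>\<^sub>z > 0" "q > 0"
  shows "(\<integral>\<^sup>+(A, z). ennreal (exp (- a * energy n m A z c)) \<partial>noise_law \<sigma>\<^sub>a \<sigma>\<^sub>z n m) =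
    ennreal ((1 / sqrt q) ^ n)"
proof -
  interpret pair_sigma_finite "gaussian_matrix \<sigma>\<^sub>a n m" "gaussian_vector \<sigma>\<^sub>z n"
    using assms pair_sigma_finite_noise by blast
  define q1 where "q1 = 1 + 2 * a * \<sigma>\<^sub>a\<^sup>2 * (\<Sum>j\<in>{1..m}. (c j)\<^sup>2)"
  define q2 where "q2 = 1 + 2 * (a / q1) * \<sigma>\<^sub>z\<^sup>2 * 1\<^sup>2"
  have q': "q = q1 + 2 * a * \<sigma>\<^sub>z\<^sup>2"
    by (simp add: q_def q1_def algebra_simps)
  have q1: "q1 > 0"
  proof (cases "a \<ge> 0")
    case True
    then show ?thesis by (auto simp: q1_def intro!: add_pos_nonneg mult_nonneg_nonneg sum_nonneg)
  next
    case False
    then have "2 * a * \<sigma>\<^sub>z\<^sup>2 \<le> 0" by (simp add: mult_nonpos_nonneg)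
    then show ?thesis using assms(4) q' by linarith
  qed
  have qq: "q1 * q2 = q"
    using q1 by (simp add: q2_def q' field_simps)
  have q2: "q2 > 0"
    using qq assms(4) q1 by (metis zero_less_mult_pos)
  have "(\<integral>\<^sup>+(A, z). ennreal (exp (- a * energy n m A z c)) \<partial>noise_law \<sigma>\<^sub>a \<sigma>\<^sub>z n m) =
    (\<integral>\<^sup>+z. (\<integral>\<^sup>+A. ennreal (exp (- a * energy n m A z c)) \<partial>gaussian_matrix \<sigma>\<^sub>a n m) \<partial>gaussian_vector \<sigma>\<^sub>z n)"
    by (subst nn_integral_snd[symmetric]) (simp_all add: case_prod_unfold)
  also have "\<dots> = (\<integral>\<^sup>+z. ennreal ((1 / sqrt q1) ^ n) *
      ennreal (exp (- (a / q1) * (\<Sum>i\<in>{1..n}. (0 + 1 * z i)\<^sup>2))) \<partial>gaussian_vector \<sigma>\<^sub>z n)"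
    unfolding energy_def gaussian_matrix_def
    using assms(2) q1
    by (intro nn_integral_cong, subst nn_integral_gaussian_matrix)
      (simp_all add: q1_def ennreal_mult del: One_nat_def)
  also have "\<dots> = ennreal ((1 / sqrt q1) ^ n) * (\<integral>\<^sup>+z.
      ennreal (exp (- (a / q1) * (\<Sum>i\<in>{1..n}. (0 + 1 * z i)\<^sup>2))) \<partial>gaussian_vector \<sigma>\<^sub>z n)"
    by (rule nn_integral_cmult) measurable
  also have "\<dots> = ennreal ((1 / sqrt q1) ^ n) * ennreal ((1 / sqrt q2) ^ n)"
    unfolding gaussian_vector_def using q2 assms(3)
    by (subst nn_integral_gaussian_column) (simp_all add: q2_def)
  also have "\<dots> = ennreal ((1 / sqrt q) ^ n)"
    using q1 q2 unfolding qq[symmetric]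
    by (subst ennreal_mult[symmetric]) (simp_all add: power_mult_distrib[symmetric] real_sqrt_mult)
  finally show ?thesis .
qed

section \<open>Chernoff bounds\<close>

text \<open>The power \<open>chernoff_base x ^ n\<close> is the optimal Chernoff bound for a
  chi-square variable with \<open>n\<close> degrees of freedom to lie beyond \<open>x * n\<close>:
  below it for \<open>x < 1\<close>, above it for \<open>x > 1\<close>.\<close>

definition chernoff_base :: "real \<Rightarrow> real" where
  "chernoff_base x = sqrt (x * exp (1 - x))"

lemma chernoff_base_pos: "x > 0 \<Longrightarrow> chernoff_base x > 0"
  by (simp add: chernoff_base_def)

text \<open>Strictness of \<open>ln x < x - 1\<close> away from 1 is what makes both tails decay
  exponentially.\<close>

lemma chernoff_base_less_1:
  assumes "x > 0" "x \<noteq> 1"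
  shows "chernoff_base x < 1"
proof -
  have "ln x < x - 1"
    using assms ln_le_minus_one[of x] ln_eq_minus_one[of x] by linarith
  then have "x < exp (x - 1)"
    using assms by (metis exp_less_cancel_iff exp_ln)
  then have "x * exp (1 - x) < exp (x - 1) * exp (1 - x)"
    by simp
  then show ?thesis
    by (simp add: chernoff_base_def flip: exp_add)
qed

text \<open>The sign condition covers both tails: it holds if \<open>\<rho> < v\<close> and \<open>v\<close> is at most the variance
  of each coordinate (lower tail), and also if both inequalities are reversed (upper tail).\<close>

lemma nn_integral_energy_tail:
  fixes \<rho> v \<sigma>\<^sub>a \<sigma>\<^sub>z :: real and c :: "nat \<Rightarrow> real"
  assumes "\<sigma>\<^sub>a > 0" "\<sigma>\<^sub>z > 0" "\<rho> > 0" "v > 0"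
    and sgn: "(1 / \<rho> - 1 / v) * (\<sigma>\<^sub>z\<^sup>2 + \<sigma>\<^sub>a\<^sup>2 * (\<Sum>j\<in>{1..m}. (c j)\<^sup>2) - v) \<ge> 0"
  shows "(\<integral>\<^sup>+(A, z). ennreal (exp (- ((1 / \<rho> - 1 / v) / 2) * (energy n m A z c - n * \<rho>)))
      \<partial>noise_law \<sigma>\<^sub>a \<sigma>\<^sub>z n m) \<le> ennreal (chernoff_base (\<rho> / v) ^ n)"
proof -
  \<comment> \<open>The optimal exponent if the variance were exactly \<open>v\<close>; it is
    negative in the upper tail.\<close>
  define a where "a = (1 / \<rho> - 1 / v) / 2"
  define q where "q = 1 + 2 * a * (\<sigma>\<^sub>z\<^sup>2 + \<sigma>\<^sub>a\<^sup>2 * (\<Sum>j\<in>{1..m}. (c j)\<^sup>2))"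
  have av: "1 + 2 * a * v = v / \<rho>" and a\<rho>: "2 * a * \<rho> = 1 - \<rho> / v"
    using assms by (simp_all add: a_def field_simps)
  have "q = 1 + 2 * a * v + (1 / \<rho> - 1 / v) * (\<sigma>\<^sub>z\<^sup>2 + \<sigma>\<^sub>a\<^sup>2 * (\<Sum>j\<in>{1..m}. (c j)\<^sup>2) - v)"
    unfolding q_def a_def by algebra
  \<comment> \<open>By the sign condition, passing from the variance \<open>v\<close> to the true
    one can only increase \<open>q\<close>, hence only lower the moment.\<close>
  then have q: "q \<ge> v / \<rho>"
    using sgn av by linarith
  have q0: "q > 0"
    using q assms by (meson divide_pos_pos less_le_trans)
  have eq: "ennreal (exp (- a * (energy n m A z c - n * \<rho>))) =
      ennreal (exp (a * n * \<rho>)) * ennreal (exp (- a * energy n m A z c))" for A z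
    by (simp add: ennreal_mult[symmetric] exp_add[symmetric] algebra_simps)
  have "(\<integral>\<^sup>+(A, z). ennreal (exp (- a * (energy n m A z c - n * \<rho>))) \<partial>noise_law \<sigma>\<^sub>a \<sigma>\<^sub>z n m)
    = ennreal (exp (a * n * \<rho>)) * (\<integral>\<^sup>+(A, z). ennreal (exp (- a * energy n m A z c)) \<partial>noise_law \<sigma>\<^sub>a \<sigma>\<^sub>z n m)"
    unfolding eq by (subst nn_integral_cmult[symmetric]) (simp_all add: case_prod_unfold)
  also have "\<dots> = ennreal (exp (a * n * \<rho>) * (1 / sqrt q) ^ n)"
    using q0 assms(1,2) unfolding q_def
    by (subst nn_integral_exp_energy) (auto simp: ennreal_mult)
  also have "\<dots> \<le> ennreal (chernoff_base (\<rho> / v) ^ n)"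
  proof (rule ennreal_leI)
    have "1 / sqrt q \<le> 1 / sqrt (v / \<rho>)"
      using q q0 assms by (intro divide_left_mono mult_pos_pos) (auto simp: field_simps)
    also have "\<dots> = sqrt (\<rho> / v)"
      by (simp add: real_sqrt_divide)
    finally have le: "1 / sqrt q \<le> sqrt (\<rho> / v)" .
    have "exp (a * n * \<rho>) * (1 / sqrt q) ^ n = (exp (a * \<rho>) * (1 / sqrt q)) ^ n"
      by (simp add: power_mult_distrib power_divide exp_of_nat_mult[symmetric] mult_ac)
    also have "\<dots> \<le> (exp (a * \<rho>) * sqrt (\<rho> / v)) ^ n"
      using le q0 by (intro power_mono mult_left_mono) auto
    also have "exp (a * \<rho>) = sqrt (exp (1 - \<rho> / v))"
    proof -
      have "exp (1 - \<rho> / v) = (exp (a * \<rho>))\<^sup>2"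
        unfolding a\<rho>[symmetric] by (simp add: power2_eq_square flip: exp_add)
      then show ?thesis by simp
    qed
    finally show "exp (a * n * \<rho>) * (1 / sqrt q) ^ n \<le> chernoff_base (\<rho> / v) ^ n"
      unfolding chernoff_base_def real_sqrt_mult by (simp only: mult.commute)
  qed
  finally show ?thesis
    by (simp add: a_def)
qed

text \<open>Conditionally on the columns outside \<open>K\<close> and the noise, the columns in \<open>K\<close> contribute exactly
  \<open>exp (- (l / q) * energy)\<close> of the remaining coefficients, which the second exponential cancels.\<close>

lemma nn_integral_energy_diff:
  fixes l \<sigma>\<^sub>a \<sigma>\<^sub>z :: real and n m :: nat and K :: "nat set" and c :: "nat \<Rightarrow> real"
  defines "q \<equiv> 1 + 2 * l * \<sigma>\<^sub>a\<^sup>2 * (\<Sum>j\<in>K. (c j)\<^sup>2)"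
  assumes "\<sigma>\<^sub>a > 0" "\<sigma>\<^sub>z > 0" "q > 0" "K \<subseteq> {1..m}"
  shows "(\<integral>\<^sup>+(A, z). ennreal (exp (- l * energy n m A z c +
      l / q * energy n m A z (\<lambda>j. if j \<in> K then 0 else c j))) \<partial>noise_law \<sigma>\<^sub>a \<sigma>\<^sub>z n m) =
    ennreal ((1 / sqrt q) ^ n)"
proof -
  interpret pair_sigma_finite "gaussian_matrix \<sigma>\<^sub>a n m" "gaussian_vector \<sigma>\<^sub>z n"
    using assms pair_sigma_finite_noise by blast
  interpret P: product_sigma_finite "\<lambda>_::nat \<times> nat. gaussian \<sigma>\<^sub>a"
    using assms product_sigma_finite_gaussian by blast
  define I where "I = {1..n}"
  define J where "J = {1..m} - K"
  have [simp]: "finite I" "finite J" "finite K"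
    using assms(5) finite_subset by (auto simp: I_def J_def)
  have split: "{1..n} \<times> {1..m} = I \<times> J \<union> I \<times> K"
    using assms(5) by (auto simp: I_def J_def)
  have disj: "(I \<times> J) \<inter> (I \<times> K) = {}" "J \<inter> K = {}" "{1..m} = J \<union> K"
    using assms(5) by (auto simp: J_def)
  define c' where "c' = (\<lambda>j. if j \<in> K then 0 else c j)"
  define F where "F = (\<lambda>z A. ennreal (exp (- l * energy n m A z c + l / q * energy n m A z c')))"
  have F: "F z \<in> borel_measurable (PiM (I \<times> J \<union> I \<times> K) (\<lambda>_. gaussian \<sigma>\<^sub>a))" for z
    unfolding F_def split[symmetric] gaussian_matrix_def[symmetric]
    using measurable_energy_fst[measurable] by measurable
  have inner: "(\<integral>\<^sup>+A. F z A \<partial>gaussian_matrix \<sigma>\<^sub>a n m) = ennreal ((1 / sqrt q) ^ n)" for z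
  proof -
    have "(\<integral>\<^sup>+A. F z A \<partial>gaussian_matrix \<sigma>\<^sub>a n m) =
      (\<integral>\<^sup>+x. (\<integral>\<^sup>+y. F z (merge (I \<times> J) (I \<times> K) (x, y)) \<partial>(\<Pi>\<^sub>M ij\<in>I \<times> K. gaussian \<sigma>\<^sub>a))
         \<partial>(\<Pi>\<^sub>M ij\<in>I \<times> J. gaussian \<sigma>\<^sub>a))"
      unfolding gaussian_matrix_def split
      by (intro P.product_nn_integral_fold F disj) auto
    also have "\<dots> = (\<integral>\<^sup>+x. ennreal ((1 / sqrt q) ^ n) \<partial>(\<Pi>\<^sub>M ij\<in>I \<times> J. gaussian \<sigma>\<^sub>a))"
    proof (intro nn_integral_cong)
      fix x :: "nat \<times> nat \<Rightarrow> real"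
      \<comment> \<open>All that stays fixed while only the columns in \<open>K\<close> are
        integrated.\<close>
      define u where "u = (\<lambda>i. z i + (\<Sum>j\<in>J. c j * x (i, j)))"
      have e1: "energy n m (merge (I \<times> J) (I \<times> K) (x, y)) z c =
          (\<Sum>i\<in>I. (u i + (\<Sum>j\<in>K. c j * y (i, j)))\<^sup>2)" for y
        unfolding energy_def I_def[symmetric]
      proof (intro sum.cong refl, goal_cases)
        case (1 i)
        have "(\<Sum>j\<in>{1..m}. c j * merge (I \<times> J) (I \<times> K) (x, y) (i, j)) =
          (\<Sum>j\<in>J. c j * x (i, j)) + (\<Sum>j\<in>K. c j * y (i, j))"
          unfolding disj(3) using 1 disj(2)
          by (subst sum.union_disjoint) (auto simp: merge_def intro!: arg_cong2[where f = plus] sum.cong)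
        then show ?case by (simp add: u_def add.assoc)
      qed
      have e2: "energy n m (merge (I \<times> J) (I \<times> K) (x, y)) z c' = (\<Sum>i\<in>I. (u i)\<^sup>2)" for y
        unfolding energy_def I_def[symmetric]
      proof (intro sum.cong refl, goal_cases)
        case (1 i)
        have "(\<Sum>j\<in>{1..m}. c' j * merge (I \<times> J) (I \<times> K) (x, y) (i, j)) =
          (\<Sum>j\<in>J. c j * x (i, j)) + (\<Sum>j\<in>K. 0)"
          unfolding disj(3) using 1 disj(2)
          by (subst sum.union_disjoint) (auto simp: merge_def c'_def intro!: arg_cong2[where f = plus] sum.cong)
        then show ?case by (simp add: u_def)
      qed
      have "(\<integral>\<^sup>+y. F z (merge (I \<times> J) (I \<times> K) (x, y)) \<partial>(\<Pi>\<^sub>M ij\<in>I \<times> K. gaussian \<sigma>\<^sub>a)) =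
        (\<integral>\<^sup>+y. ennreal (exp (- l * (\<Sum>i\<in>I. (u i + (\<Sum>j\<in>K. c j * y (i, j)))\<^sup>2))) *
            ennreal (exp (l / q * (\<Sum>i\<in>I. (u i)\<^sup>2))) \<partial>(\<Pi>\<^sub>M ij\<in>I \<times> K. gaussian \<sigma>\<^sub>a))"
        unfolding F_def e1 e2 exp_add by (simp add: ennreal_mult)
      also have "\<dots> = (\<integral>\<^sup>+y. ennreal (exp (- l * (\<Sum>i\<in>I. (u i + (\<Sum>j\<in>K. c j * y (i, j)))\<^sup>2))) \<partial>(\<Pi>\<^sub>M ij\<in>I \<times> K. gaussian \<sigma>\<^sub>a))
          * ennreal (exp (l / q * (\<Sum>i\<in>I. (u i)\<^sup>2)))"
        by (rule nn_integral_multc) measurable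
      also have "\<dots> = ennreal ((1 / sqrt q) ^ card I * exp (- (l / q) * (\<Sum>i\<in>I. (u i)\<^sup>2))) *
            ennreal (exp (l / q * (\<Sum>i\<in>I. (u i)\<^sup>2)))"
        using assms(2,4) by (subst nn_integral_gaussian_matrix) (simp_all add: q_def)
      also have "\<dots> = ennreal ((1 / sqrt q) ^ n)"
        using assms(4) by (subst ennreal_mult[symmetric]) (simp_all add: I_def exp_minus field_simps)
      finally show "(\<integral>\<^sup>+y. F z (merge (I \<times> J) (I \<times> K) (x, y)) \<partial>(\<Pi>\<^sub>M ij\<in>I \<times> K. gaussian \<sigma>\<^sub>a)) = ennreal ((1 / sqrt q) ^ n)" .
    qed
    \<comment> \<open>The inner integral is the same constant for all \<open>x\<close> and
      \<open>z\<close>, and the outer integrals are over probability measures.\<close>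
    also have "\<dots> = ennreal ((1 / sqrt q) ^ n)"
      using prob_space_PiM[OF prob_space_gaussian[OF assms(2)], of "I \<times> J"]
      by (simp add: prob_space.emeasure_space_1)
    finally show ?thesis .
  qed
  have "(\<integral>\<^sup>+(A, z). F z A \<partial>noise_law \<sigma>\<^sub>a \<sigma>\<^sub>z n m) =
    (\<integral>\<^sup>+z. (\<integral>\<^sup>+A. F z A \<partial>gaussian_matrix \<sigma>\<^sub>a n m) \<partial>gaussian_vector \<sigma>\<^sub>z n)"
    unfolding F_def by (subst nn_integral_snd[symmetric]) (simp_all add: case_prod_unfold)
  also have "\<dots> = ennreal ((1 / sqrt q) ^ n)"
    unfolding inner using prob_space_gaussian_vector[OF assms(3)]
    by (simp add: prob_space.emeasure_space_1)
  finally show ?thesis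
    by (simp add: F_def c'_def case_prod_unfold)
qed

section \<open>The quantized least-squares decoder\<close>

text \<open>Extensionality outside \<open>{1..m}\<close> makes this set finite for finite
  \<open>Q\<close>, so that minimizers exist and the union bound is a finite sum.\<close>

definition sparse_signals :: "nat \<Rightarrow> nat \<Rightarrow> real set \<Rightarrow> (nat \<Rightarrow> real) set" where
  "sparse_signals m k Q = {y \<in> {1..m} \<rightarrow>\<^sub>E insert 0 Q. card (supp m y) = k}"

definition residual ::
    "nat \<Rightarrow> nat \<Rightarrow> (nat \<Rightarrow> real) \<times> (nat \<times> nat \<Rightarrow> real) \<Rightarrow> (nat \<Rightarrow> real) \<Rightarrow> real" where
  "residual n m p y = (\<Sum>i\<in>{1..n}. (fst p i - (\<Sum>j\<in>{1..m}. y j * snd p (i, j)))\<^sup>2)"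

definition least_squares_support ::
    "nat \<Rightarrow> nat \<Rightarrow> nat \<Rightarrow> real set \<Rightarrow> (nat \<Rightarrow> real) \<times> (nat \<times> nat \<Rightarrow> real) \<Rightarrow> nat set" where
  "least_squares_support n m k Q p = supp m (arg_min_on (residual n m p) (sparse_signals m k Q))"

lemma supp_subset: "supp m x \<subseteq> {1..m}"
  by (auto simp: supp_def)

lemma finite_supp [simp]: "finite (supp m x)"
  using finite_subset[OF supp_subset] by blast

lemma finite_sparse_signals: "finite Q \<Longrightarrow> finite (sparse_signals m k Q)"
  unfolding sparse_signals_def by (rule finite_subset[OF _ finite_PiE[of "{1..m}" "\<lambda>_. insert 0 Q"]]) auto

text \<open>With ties, the point picked by \<open>arg_min\<close> is an arbitrary choice, but one
  that depends only on the set of all minimizers. This set has finitely many possible values, each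
  described by finitely many comparisons of measurable functions.\<close>

lemma measurable_is_arg_min:
  fixes f :: "'a \<Rightarrow> 'b \<Rightarrow> real"
  assumes "finite C" and f: "\<And>y. y \<in> C \<Longrightarrow> (\<lambda>p. f p y) \<in> borel_measurable M"
  shows "(\<lambda>p. {y. is_arg_min (f p) (\<lambda>y. y \<in> C) y}) \<in> M \<rightarrow>\<^sub>M count_space (Pow C)"
proof -
  have "(\<lambda>p. {y. is_arg_min (f p) (\<lambda>y. y \<in> C) y}) -` {D} \<inter> space M \<in> sets M" if "D \<subseteq> C" for D
  proof -
    have "{y. is_arg_min (f p) (\<lambda>y. y \<in> C) y} = D \<longleftrightarrow>
        (\<forall>y\<in>C. y \<in> D \<longleftrightarrow> (\<forall>y'\<in>C. \<not> f p y' < f p y))" for p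
      unfolding is_arg_min_def using that by blast
    then have "(\<lambda>p. {y. is_arg_min (f p) (\<lambda>y. y \<in> C) y}) -` {D} \<inter> space M =
      {p \<in> space M. \<forall>y\<in>C. (y \<in> D \<longleftrightarrow> (\<forall>y'\<in>C. \<not> f p y' < f p y))}"
      by blast
    also have "\<dots> \<in> sets M"
    proof (rule sets.sets_Collect_finite_All[OF _ assms(1)])
      fix y assume y: "y \<in> C"
      have min: "{p \<in> space M. \<forall>y'\<in>C. \<not> f p y' < f p y} \<in> sets M"
      proof (rule sets.sets_Collect_finite_All[OF _ assms(1)])
        fix y' assume y': "y' \<in> C"
        show "{p \<in> space M. \<not> f p y' < f p y} \<in> sets M"
          by (rule sets.sets_Collect_neg[OF borel_measurable_less[OF f[OF y'] f[OF y]]])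
      qed
      show "{p \<in> space M. y \<in> D \<longleftrightarrow> (\<forall>y'\<in>C. \<not> f p y' < f p y)} \<in> sets M"
        using min sets.sets_Collect_neg[OF min] by (cases "y \<in> D") simp_all
    qed
    finally show ?thesis .
  qed
  moreover have "{y. is_arg_min (f p) (\<lambda>y. y \<in> C) y} \<subseteq> C" for p
    by (auto simp: is_arg_min_def)
  ultimately show ?thesis
    using assms(1) by (simp add: measurable_count_space_eq2 Pi_def)
qed

lemma least_squares_support_in_recovery_maps:
  assumes "finite Q"
  shows "least_squares_support n m k Q \<in> recovery_maps n m"
proof -
  let ?C = "sparse_signals m k Q"
  let ?M = "(\<Pi>\<^sub>M i\<in>{1..n}. borel) \<Otimes>\<^sub>M (\<Pi>\<^sub>M ij\<in>{1..n} \<times> {1..m}. borel) ::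
    ((nat \<Rightarrow> real) \<times> (nat \<times> nat \<Rightarrow> real)) measure"
  have r: "(\<lambda>p. residual n m p y) \<in> borel_measurable ?M" for y
    unfolding residual_def
    by (intro borel_measurable_sum borel_measurable_power borel_measurable_diff borel_measurable_times
        measurable_const UNIV_I
        measurable_compose[OF measurable_fst measurable_component_singleton]
        measurable_compose[OF measurable_snd measurable_component_singleton]) auto
  have G: "(\<lambda>p. {y. is_arg_min (residual n m p) (\<lambda>y. y \<in> ?C) y}) \<in> ?M \<rightarrow>\<^sub>M count_space (Pow ?C)"
    by (intro measurable_is_arg_min finite_sparse_signals assms r)
  \<comment> \<open>Every map out of a discrete space is measurable, so the Hilbert choice can be
    composed with the set of minimizers.\<close>
  have "(\<lambda>G. supp m (SOME y. y \<in> G)) \<in> count_space (Pow ?C) \<rightarrow>\<^sub>M count_space (Pow {1..m})"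
    using supp_subset by (auto simp: Pi_def)
  from measurable_compose[OF G this] show ?thesis
    by (simp add: recovery_maps_def least_squares_support_def[abs_def] arg_min_on_def arg_min_def)
qed

lemma residual_measurement:
  "residual n m (measurement n m A x z, A) y = energy n m A z (\<lambda>j. x j - y j)"
  unfolding residual_def energy_def
  by (intro sum.cong refl) (simp add: measurement_def left_diff_distrib sum_subtractf mult.commute[of "A _"] add_diff_eq add.commute)

text \<open>The true \<open>x\<close> need not have its entries in \<open>Q\<close>, so the
  minimizer is compared with a candidate \<open>x'\<close>, later the quantization of
  \<open>x\<close>.\<close>

lemma least_squares_support_energy_le:
  assumes "finite Q" "x' \<in> sparse_signals m k Q"
  obtains y where "y \<in> sparse_signals m k Q"
    "supp m y = least_squares_support n m k Q (measurement n m A x z, A)"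
    "energy n m A z (\<lambda>j. x j - y j) \<le> energy n m A z (\<lambda>j. x j - x' j)"
proof
  let ?r = "residual n m (measurement n m A x z, A)"
  let ?y = "arg_min_on ?r (sparse_signals m k Q)"
  have fin: "finite (sparse_signals m k Q)" "sparse_signals m k Q \<noteq> {}"
    using assms finite_sparse_signals by auto
  show "?y \<in> sparse_signals m k Q"
    using arg_min_if_finite[OF fin] by blast
  show "supp m ?y = least_squares_support n m k Q (measurement n m A x z, A)"
    by (simp add: least_squares_support_def)
  show "energy n m A z (\<lambda>j. x j - ?y j) \<le> energy n m A z (\<lambda>j. x j - x' j)"
    using arg_min_if_finite(2)[OF fin, of ?r] assms(2)
    unfolding residual_measurement[symmetric] by (meson not_le)
qed

section \<open>Counting the candidates by their number of wrong positions\<close>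

lemma binomial_le_power: "n choose k \<le> n ^ k"
proof (cases "k \<le> n")
  case True
  then show ?thesis by (rule binomial_le_pow)
qed (simp add: binomial_eq_0)

text \<open>There are at most \<open>m ^ t\<close> choices for the set \<open>K\<close> of wrong
  positions. Given \<open>K\<close>, the candidate vanishes outside \<open>X \<union> K\<close>,
  which has at most \<open>2 * k\<close> elements, and takes at most \<open>card Q + 1\<close>
  values at each of them.\<close>

lemma card_sparse_signals_le:
  assumes "finite Q" "X \<subseteq> {1..m}" "card X = k" "t \<le> k"
  shows "card {y \<in> sparse_signals m k Q. card (supp m y - X) = t} \<le> m ^ t * (card Q + 1) ^ (2 * k)"
proof -
  have finX: "finite X" using assms(2) finite_subset by blast
  let ?\<K> = "{K. K \<subseteq> {1..m} \<and> card K = t}"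
  let ?P = "\<lambda>K. PiE {1..m} (\<lambda>j. if j \<in> X \<union> K then insert 0 Q else {0})"
  have "{y \<in> sparse_signals m k Q. card (supp m y - X) = t} \<subseteq> (\<Union>K\<in>?\<K>. ?P K)"
  proof safe
    fix y assume y: "y \<in> sparse_signals m k Q" "t = card (supp m y - X)"
    have "y \<in> ?P (supp m y - X)"
      using y(1) unfolding sparse_signals_def by (auto simp: PiE_iff supp_def)
    moreover have "supp m y - X \<subseteq> {1..m}"
      using supp_subset by blast
    ultimately show "y \<in> (\<Union>K\<in>{K. K \<subseteq> {1..m} \<and> card K = card (supp m y - X)}. ?P K)"
      by blast
  qed
  then have "card {y \<in> sparse_signals m k Q. card (supp m y - X) = t} \<le> card (\<Union>K\<in>?\<K>. ?P K)"
    using assms(1) by (intro card_mono finite_UN_I finite_PiE) (auto split: if_splits)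
  also have "\<dots> \<le> (\<Sum>K\<in>?\<K>. card (?P K))"
    by (rule card_UN_le) auto
  also have "\<dots> \<le> (\<Sum>K\<in>?\<K>. (card Q + 1) ^ (2 * k))"
  proof (rule sum_mono)
    fix K assume K: "K \<in> ?\<K>"
    then have finK: "finite K" using finite_subset by blast
    have "card (?P K) = (\<Prod>j\<in>{1..m}. if j \<in> X \<union> K then card (insert 0 Q) else 1)"
      by (subst card_PiE) (auto intro!: prod.cong)
    also have "\<dots> = (\<Prod>j\<in>X \<union> K. card (insert 0 Q))"
      using K assms(2) by (intro prod.mono_neutral_cong_right) auto
    also have "\<dots> = card (insert 0 Q) ^ card (X \<union> K)"
      by simp
    also have "\<dots> \<le> (card Q + 1) ^ card (X \<union> K)"
      using assms(1) by (intro power_mono) (auto simp: card_insert_if)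
    also have "\<dots> \<le> (card Q + 1) ^ (2 * k)"
      using card_Un_le[of X K] K assms by (intro power_increasing) auto
    finally show "card (?P K) \<le> (card Q + 1) ^ (2 * k)" .
  qed
  also have "\<dots> = (m choose t) * (card Q + 1) ^ (2 * k)"
    using n_subsets[of "{1..m}" t] by simp
  also have "\<dots> \<le> m ^ t * (card Q + 1) ^ (2 * k)"
    using binomial_le_power by simp
  finally show ?thesis .
qed

lemma card_diff_eq_of_card_eq:
  assumes "finite X" "finite Y" "card X = card Y"
  shows "card (X - Y) = card (Y - X)"
  using assms card_Int_Diff[of X Y] card_Int_Diff[of Y X] by (simp add: Int_commute)

text \<open>This is the counting half of the union bound: a candidate with \<open>t\<close> wrong
  positions has weight \<open>1 / m ^ t\<close>, which cancels the \<open>m ^ t\<close> choices of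
  these positions. What remains is polynomial in the size of the grid.\<close>

lemma sum_sparse_signals_le:
  assumes "finite Q" "X \<subseteq> {1..m}" "card X = k" "m > 0"
  shows "(\<Sum>y | y \<in> sparse_signals m k Q \<and> supp m y \<noteq> X. 1 / real m ^ card (supp m y - X))
    \<le> k * (real (card Q) + 1) ^ (2 * k)"
proof -
  have finX: "finite X" using assms(2) finite_subset by blast
  let ?E = "{y. y \<in> sparse_signals m k Q \<and> supp m y \<noteq> X}"
  have fin: "finite ?E"
    using finite_sparse_signals[OF assms(1)] by auto
  \<comment> \<open>Both supports have \<open>k\<close> elements, so a different support contains at
    least one wrong position.\<close>
  have range: "card (supp m y - X) \<in> {1..k}" if "y \<in> ?E" for y
  proof -
    have c: "card (supp m y) = card X" "supp m y \<noteq> X"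
      using that assms(3) by (auto simp: sparse_signals_def)
    then have "supp m y - X \<noteq> {}"
      using card_subset_eq[OF finX, of "supp m y"] by auto
    moreover have "card (supp m y - X) \<le> card (supp m y)"
      by (intro card_mono) auto
    ultimately show ?thesis
      using c(1) assms(3) by (simp add: Suc_le_eq card_gt_0_iff)
  qed
  have "(\<Sum>y\<in>?E. 1 / real m ^ card (supp m y - X)) =
    (\<Sum>t\<in>{1..k}. \<Sum>y | y \<in> ?E \<and> card (supp m y - X) = t. 1 / real m ^ card (supp m y - X))"
    using range by (intro sum.group[symmetric] fin image_subsetI range) auto
  also have "\<dots> \<le> (\<Sum>t\<in>{1..k}. (real (card Q) + 1) ^ (2 * k))"
  proof (rule sum_mono)
    fix t assume t: "t \<in> {1..k}"
    have "(\<Sum>y | y \<in> ?E \<and> card (supp m y - X) = t. 1 / real m ^ card (supp m y - X)) =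
      real (card {y. y \<in> ?E \<and> card (supp m y - X) = t}) / real m ^ t"
      by simp
    also have "\<dots> \<le> real (card {y \<in> sparse_signals m k Q. card (supp m y - X) = t}) / real m ^ t"
      using finite_sparse_signals[OF assms(1)]
      by (intro divide_right_mono of_nat_mono card_mono) auto
    also have "\<dots> \<le> real (m ^ t * (card Q + 1) ^ (2 * k)) / real m ^ t"
      using card_sparse_signals_le[OF assms(1-3), of t] t
      by (intro divide_right_mono of_nat_mono) auto
    also have "\<dots> = (real (card Q) + 1) ^ (2 * k)"
      using assms(4) by (simp add: add.commute)
    finally show "(\<Sum>y | y \<in> ?E \<and> card (supp m y - X) = t. 1 / real m ^ card (supp m y - X))
      \<le> (real (card Q) + 1) ^ (2 * k)" .
  qed
  finally show ?thesis by simp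
qed

section \<open>The error event for a fixed signal\<close>

lemma energy_cong: "(\<And>j. j \<in> {1..m} \<Longrightarrow> c j = c' j) \<Longrightarrow> energy n m A z c = energy n m A z c'"
  unfolding energy_def by (intro sum.cong arg_cong2[where f = plus] arg_cong[where f = "\<lambda>x. x\<^sup>2"]) auto

text \<open>With \<open>x\<close> the signal and \<open>x'\<close> its quantization, an error needs a candidate \<open>y\<close> with wrong
  support whose residual is below that of \<open>x'\<close>. So one of three things happens: the residual
  of \<open>x'\<close> exceeds \<open>\<rho>\<close>; for some \<open>g\<close> (the restriction of \<open>y\<close> to the true support), the
  part of the residual of \<open>y\<close> that does not involve the wrongly chosen columns is below \<open>\<tau>\<close>;
  or it is not, but the wrongly chosen columns bring it from \<open>\<tau>\<close> down to \<open>\<rho>\<close>. Only the last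
  event must be summed over all \<open>y\<close>, and it has probability at most \<open>(\<rho> / \<tau>) powr (n / 2)\<close>.\<close>

lemma error_majorant:
  fixes \<sigma>\<^sub>a \<sigma>\<^sub>z h M :: real and n m k :: nat and x x' :: "nat \<Rightarrow> real" and Q :: "real set"
  assumes \<sigma>: "\<sigma>\<^sub>a > 0" "\<sigma>\<^sub>z > 0" and Q: "finite Q" "0 \<notin> Q" and m: "m > 0"
    and x': "x' \<in> sparse_signals m k Q" "supp m x' = supp m x"
    and h: "0 < h" "h < 1" and M: "M \<ge> 1" "real m \<le> M ^ n"
    and near: "\<sigma>\<^sub>a\<^sup>2 * (\<Sum>j\<in>{1..m}. (x j - x' j)\<^sup>2) \<le> h * \<sigma>\<^sub>z\<^sup>2"
    and sep: "\<And>D. D \<subseteq> supp m x \<Longrightarrow> D \<noteq> {} \<Longrightarrow>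
      (1 + h) ^ 3 * \<sigma>\<^sub>z\<^sup>2 * M ^ (2 * card D) \<le> (1 - h) * (\<sigma>\<^sub>z\<^sup>2 + \<sigma>\<^sub>a\<^sup>2 * (\<Sum>j\<in>D. (x j)\<^sup>2))"
  obtains F where "F \<in> borel_measurable (noise_law \<sigma>\<^sub>a \<sigma>\<^sub>z n m)"
    "\<And>A z. least_squares_support n m k Q (measurement n m A x z, A) \<noteq> supp m x \<Longrightarrow> (1::ennreal) \<le> F (A, z)"
    "(\<integral>\<^sup>+\<omega>. F \<omega> \<partial>noise_law \<sigma>\<^sub>a \<sigma>\<^sub>z n m) \<le> ennreal (chernoff_base (1 + h) ^ n +
       (real (card Q) + 1) ^ k * chernoff_base (1 - h) ^ n +
       k * (real (card Q) + 1) ^ (2 * k) * (1 / sqrt (1 + h)) ^ n)"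
proof -
  define X where "X = supp m x"
  \<comment> \<open>\<open>S D\<close> bounds from below the variance of a coordinate of
    \<open>U\<close> when \<open>D\<close> is missed, and \<open>\<tau> D\<close> lies slightly
    below it. By \<open>near\<close>, \<open>v0\<close> bounds from above the variance belonging to
    \<open>x'\<close>, and \<open>\<rho>\<close> lies slightly above it. The ratios
    \<open>1 - h\<close> and \<open>1 + h\<close> are the arguments of the two Chernoff
    bounds.\<close>
  define S where "S = (\<lambda>D. \<sigma>\<^sub>z\<^sup>2 + \<sigma>\<^sub>a\<^sup>2 * (\<Sum>j\<in>D. (x j)\<^sup>2))"
  define \<tau> where "\<tau> = (\<lambda>D. (1 - h) * S D)"
  define v0 where "v0 = \<sigma>\<^sub>z\<^sup>2 * (1 + h)"
  define \<rho> where "\<rho> = \<sigma>\<^sub>z\<^sup>2 * (1 + h)\<^sup>2"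
  \<comment> \<open>\<open>G\<close> contains the restrictions to \<open>X\<close> of all wrong
    candidates, and its size is bounded independently of \<open>m\<close>. For such a
    \<open>g\<close>, \<open>D g\<close> is the set of missed positions and \<open>c g\<close> holds
    the coefficients left after removing the wrongly chosen columns.\<close>
  define G where "G = {g \<in> X \<rightarrow>\<^sub>E insert 0 Q. \<exists>i\<in>X. g i = 0}"
  define D where "D = (\<lambda>g. {i \<in> X. g i = (0::real)})"
  define c where "c = (\<lambda>g j. if j \<in> X then x j - g j else 0)"
  define Y where "Y = {y. y \<in> sparse_signals m k Q \<and> supp m y \<noteq> X}"
  define K where "K = (\<lambda>y. supp m y - X)"
  \<comment> \<open>\<open>l\<close> is the solution of \<open>1 + 2 * l * \<sigma>\<^sub>a\<^sup>2
    * (\<Sum>j\<in>K y. (x j - y j)\<^sup>2) = q\<close>. With \<open>q = \<tau> / \<rho>\<close>,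
    the thresholds balance: \<open>l * (n * \<rho>) = l / q * (n * \<tau>)\<close>. The resulting
    moment \<open>(1 / sqrt q) ^ n\<close> is free of the values of \<open>y\<close> on
    \<open>K y\<close>.\<close>
  define q where "q = (\<lambda>y. \<tau> (D y) / \<rho>)"
  define l where "l = (\<lambda>y. (q y - 1) / (2 * \<sigma>\<^sub>a\<^sup>2 * (\<Sum>j\<in>K y. (x j - y j)\<^sup>2)))"
  have X: "X \<subseteq> {1..m}" "finite X" "card X = k"
    using supp_subset x' by (auto simp: X_def sparse_signals_def)
  have S: "S D' > 0" for D'
    using \<sigma> by (auto simp: S_def intro!: add_pos_nonneg mult_nonneg_nonneg sum_nonneg)
  have \<tau>: "\<tau> D' > 0" for D'
    using S h by (simp add: \<tau>_def)
  have \<rho>: "\<rho> > 0" and v0: "v0 > 0" "\<rho> / v0 = 1 + h"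
    using \<sigma> h by (simp_all add: \<rho>_def v0_def power2_eq_square)
  have "v0 \<le> \<rho>"
    using v0 h by (simp add: field_simps)
  then have inv0: "1 / \<rho> - 1 / v0 \<le> 0"
    using v0(1) by (simp add: frac_le)
  have finG: "finite G"
    unfolding G_def using X(2) Q(1)
    by (intro finite_subset[OF _ finite_PiE[of X "\<lambda>_. insert 0 Q"]]) auto
  have finY: "finite Y"
    unfolding Y_def using finite_sparse_signals[OF Q(1)] by simp
  have cardG: "real (card G) \<le> (real (card Q) + 1) ^ k"
  proof -
    have "card G \<le> card (X \<rightarrow>\<^sub>E insert 0 Q)"
      unfolding G_def using X(2) Q(1) by (intro card_mono finite_PiE) auto
    also have "\<dots> = (card Q + 1) ^ k"
      using X Q by (simp add: card_PiE)
    finally have "real (card G) \<le> real ((card Q + 1) ^ k)" by (rule of_nat_mono)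
    then show ?thesis by (simp add: add.commute)
  qed

  \<comment> \<open>Markov's inequality in pointwise form: each exponential is at least 1 on its own
    event, so \<open>F\<close> dominates the indicator of an error.\<close>
  define F0 where "F0 = (\<lambda>\<omega>. ennreal (exp (- ((1 / \<rho> - 1 / v0) / 2) *
    (energy n m (fst \<omega>) (snd \<omega>) (\<lambda>j. x j - x' j) - n * \<rho>))))"
  define F1 where "F1 = (\<lambda>g \<omega>. ennreal (exp (- ((1 / \<tau> (D g) - 1 / S (D g)) / 2) *
    (energy n m (fst \<omega>) (snd \<omega>) (c g) - n * \<tau> (D g)))))"
  define F2 where "F2 = (\<lambda>y \<omega>. ennreal (exp (- l y * energy n m (fst \<omega>) (snd \<omega>) (\<lambda>j. x j - y j) +
    l y / q y * energy n m (fst \<omega>) (snd \<omega>) (\<lambda>j. if j \<in> K y then 0 else x j - y j))))"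
  define F where "F = (\<lambda>\<omega>. F0 \<omega> + (\<Sum>g\<in>G. F1 g \<omega>) + (\<Sum>y\<in>Y. F2 y \<omega>))"
  have [measurable]: "F0 \<in> borel_measurable (noise_law \<sigma>\<^sub>a \<sigma>\<^sub>z n m)"
    "F1 g \<in> borel_measurable (noise_law \<sigma>\<^sub>a \<sigma>\<^sub>z n m)"
    "F2 y \<in> borel_measurable (noise_law \<sigma>\<^sub>a \<sigma>\<^sub>z n m)" for g y
    unfolding F0_def F1_def F2_def by measurable

  have Yprops: "D y \<subseteq> X" "D y \<noteq> {}" "card (D y) = card (K y)" "K y \<subseteq> {1..m}"
      "(\<Sum>j\<in>K y. (x j - y j)\<^sup>2) > 0" "restrict y X \<in> G" "D (restrict y X) = D y"
    if y: "y \<in> Y" for y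
  proof -
    have cy: "card (supp m y) = card X" "supp m y \<noteq> X"
      using y X by (auto simp: Y_def sparse_signals_def)
    have Dy: "D y = X - supp m y"
      using X(1) by (auto simp: D_def supp_def)
    show "D y \<subseteq> X" by (auto simp: D_def)
    \<comment> \<open>As both supports have \<open>k\<close> elements, as many positions are missed
      as are wrongly chosen; this ties the variance of \<open>U\<close> to the number of
      candidates.\<close>
    show DK: "card (D y) = card (K y)"
      unfolding Dy K_def using X(2) cy by (intro card_diff_eq_of_card_eq) auto
    show D0: "D y \<noteq> {}"
      using card_subset_eq[of "supp m y" X] cy unfolding Dy by auto
    then have K0: "K y \<noteq> {}"
      using DK X(2) by (metis Dy card_0_eq card.empty finite_Diff)
    show "K y \<subseteq> {1..m}"
      using supp_subset by (auto simp: K_def)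
    show "(\<Sum>j\<in>K y. (x j - y j)\<^sup>2) > 0"
      using K0 by (intro sum_pos) (auto simp: K_def X_def supp_def)
    show "D (restrict y X) = D y"
      by (auto simp: D_def)
    show "restrict y X \<in> G"
      using y D0 X(1) by (auto simp: G_def Y_def sparse_signals_def D_def PiE_iff)
  qed
  have q: "q y \<ge> (1 + h) * M ^ (2 * card (K y))" "q y > 1" "l y > 0"
      "1 + 2 * l y * \<sigma>\<^sub>a\<^sup>2 * (\<Sum>j\<in>K y. (x j - y j)\<^sup>2) = q y" if y: "y \<in> Y" for y
  proof -
    note Y = Yprops[OF y]
    have "(1 + h) ^ 3 * \<sigma>\<^sub>z\<^sup>2 * M ^ (2 * card (K y)) \<le> \<tau> (D y)"
      using sep[of "D y"] Y unfolding X_def \<tau>_def S_def by simp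
    \<comment> \<open>Two of the three factors \<open>1 + h\<close> go into \<open>\<rho>\<close>;
      the third survives as the rate of exponential decay.\<close>
    moreover have "(1 + h) ^ 3 * \<sigma>\<^sub>z\<^sup>2 * M ^ (2 * card (K y)) = ((1 + h) * M ^ (2 * card (K y))) * \<rho>"
      by (simp add: \<rho>_def power3_eq_cube power2_eq_square)
    ultimately show q1: "q y \<ge> (1 + h) * M ^ (2 * card (K y))"
      using \<rho> by (simp only: q_def pos_le_divide_eq)
    have "(1 + h) * 1 \<le> (1 + h) * M ^ (2 * card (K y))"
      using M(1) h by (intro mult_left_mono one_le_power) auto
    moreover have "1 < (1 + h) * 1"
      using h by simp
    ultimately show q2: "q y > 1"
      using q1 by (meson less_le_trans)
    then show "l y > 0"
      using Y(5) \<sigma> by (simp add: l_def)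
    have "2 * \<sigma>\<^sub>a\<^sup>2 * (\<Sum>j\<in>K y. (x j - y j)\<^sup>2) \<noteq> 0"
      using Y(5) \<sigma> by simp
    then have "l y * (2 * \<sigma>\<^sub>a\<^sup>2 * (\<Sum>j\<in>K y. (x j - y j)\<^sup>2)) = q y - 1"
      unfolding l_def by (rule nonzero_eq_divide_eq[THEN iffD1, OF _ refl])
    then show "1 + 2 * l y * \<sigma>\<^sub>a\<^sup>2 * (\<Sum>j\<in>K y. (x j - y j)\<^sup>2) = q y"
      by (simp add: mult_ac)
  qed

  show ?thesis
  proof
    show "F \<in> borel_measurable (noise_law \<sigma>\<^sub>a \<sigma>\<^sub>z n m)"
      unfolding F_def by measurable
  next
    fix A z
    assume err: "least_squares_support n m k Q (measurement n m A x z, A) \<noteq> supp m x"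
    obtain y where y: "y \<in> sparse_signals m k Q"
      "supp m y = least_squares_support n m k Q (measurement n m A x z, A)"
      "energy n m A z (\<lambda>j. x j - y j) \<le> energy n m A z (\<lambda>j. x j - x' j)"
      using least_squares_support_energy_le[OF Q(1) x'(1)] by blast
    have yY: "y \<in> Y"
      using y err by (auto simp: Y_def X_def)
    note Y = Yprops[OF yY]
    let ?g = "restrict y X"
    \<comment> \<open>Outside \<open>X\<close> and \<open>K y\<close> both \<open>x\<close> and
      \<open>y\<close> vanish, so \<open>U\<close> depends on \<open>y\<close> only through its
      restriction to \<open>X\<close>.\<close>
    have U: "energy n m A z (\<lambda>j. if j \<in> K y then 0 else x j - y j) = energy n m A z (c ?g)"
      by (rule energy_cong) (auto simp: c_def K_def X_def supp_def)
    consider "energy n m A z (\<lambda>j. x j - x' j) \<ge> n * \<rho>"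
      | "energy n m A z (c ?g) \<le> n * \<tau> (D ?g)"
      | "energy n m A z (\<lambda>j. x j - y j) \<le> n * \<rho>" "energy n m A z (c ?g) \<ge> n * \<tau> (D y)"
      using y(3) Y(7) by fastforce
    then show "1 \<le> F (A, z)"
    proof cases
      case 1
      have "- ((1 / \<rho> - 1 / v0) / 2) * (energy n m A z (\<lambda>j. x j - x' j) - n * \<rho>) \<ge> 0"
        using 1 inv0 by (intro mult_nonneg_nonneg) auto
      then have "1 \<le> F0 (A, z)"
        by (simp add: F0_def)
      also have "\<dots> \<le> F (A, z)"
        by (simp add: F_def add.assoc)
      finally show ?thesis .
    next
      case 2
      have "\<tau> (D ?g) \<le> S (D ?g)"
        using S[of "D ?g"] h by (simp add: \<tau>_def mult_left_le_one_le)
      then have "1 / \<tau> (D ?g) - 1 / S (D ?g) \<ge> 0"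
        using \<tau> by (simp add: frac_le)
      then have "((1 / \<tau> (D ?g) - 1 / S (D ?g)) / 2) * (energy n m A z (c ?g) - n * \<tau> (D ?g)) \<le> 0"
        using 2 by (intro mult_nonneg_nonpos) auto
      then have "1 \<le> F1 ?g (A, z)"
        by (simp add: F1_def)
      also have "\<dots> \<le> (\<Sum>g\<in>G. F1 g (A, z))"
        using member_le_sum[OF Y(6), of "\<lambda>g. F1 g (A, z)"] finG by simp
      also have "\<dots> \<le> F (A, z)"
        by (simp add: F_def add.assoc add.left_commute)
      finally show ?thesis .
    next
      case 3
      note qy = q[OF yY]
      have "l y * energy n m A z (\<lambda>j. x j - y j) \<le> l y * (n * \<rho>)"
        using 3 qy(3) by (intro mult_left_mono) auto
      also have "\<dots> = l y / q y * (n * \<tau> (D y))"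
        using \<rho> qy(2) \<tau>[of "D y"] by (simp add: q_def)
      also have "\<dots> \<le> l y / q y * energy n m A z (c ?g)"
        using 3 qy(2,3) by (intro mult_left_mono) auto
      finally have "1 \<le> F2 y (A, z)"
        by (simp add: F2_def U)
      also have "\<dots> \<le> (\<Sum>y\<in>Y. F2 y (A, z))"
        using member_le_sum[OF yY, of "\<lambda>y. F2 y (A, z)"] finY by simp
      also have "\<dots> \<le> F (A, z)"
        by (simp add: F_def)
      finally show ?thesis .
    qed
  next
    have "(1 / \<rho> - 1 / v0) * (\<sigma>\<^sub>z\<^sup>2 + \<sigma>\<^sub>a\<^sup>2 * (\<Sum>j\<in>{1..m}. (x j - x' j)\<^sup>2) - v0) \<ge> 0"
      using near by (intro mult_nonpos_nonpos inv0) (simp add: v0_def algebra_simps)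
    from nn_integral_energy_tail[OF \<sigma> \<rho> v0(1) this, of n]
    have I0: "(\<integral>\<^sup>+\<omega>. F0 \<omega> \<partial>noise_law \<sigma>\<^sub>a \<sigma>\<^sub>z n m) \<le> ennreal (chernoff_base (1 + h) ^ n)"
      by (simp add: F0_def case_prod_unfold v0(2))

    have I1: "(\<integral>\<^sup>+\<omega>. F1 g \<omega> \<partial>noise_law \<sigma>\<^sub>a \<sigma>\<^sub>z n m) \<le> ennreal (chernoff_base (1 - h) ^ n)" for g
    proof -
      \<comment> \<open>On \<open>D g\<close> the candidate is 0 and \<open>c g\<close> keeps the
        full signal, so the variance is at least \<open>S (D g)\<close>.\<close>
      have "(\<Sum>j\<in>D g. (x j)\<^sup>2) = (\<Sum>j\<in>D g. (c g j)\<^sup>2)"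
        by (rule sum.cong) (auto simp: D_def c_def)
      also have "\<dots> \<le> (\<Sum>j\<in>{1..m}. (c g j)\<^sup>2)"
        using X(1) by (intro sum_mono2) (auto simp: D_def)
      finally have "\<sigma>\<^sub>z\<^sup>2 + \<sigma>\<^sub>a\<^sup>2 * (\<Sum>j\<in>{1..m}. (c g j)\<^sup>2) - S (D g) \<ge> 0"
        by (simp add: S_def mult_left_mono)
      moreover have "1 / \<tau> (D g) - 1 / S (D g) \<ge> 0"
        using S[of "D g"] \<tau>[of "D g"] h by (simp add: frac_le \<tau>_def mult_left_le_one_le)
      ultimately have "(1 / \<tau> (D g) - 1 / S (D g)) *
          (\<sigma>\<^sub>z\<^sup>2 + \<sigma>\<^sub>a\<^sup>2 * (\<Sum>j\<in>{1..m}. (c g j)\<^sup>2) - S (D g)) \<ge> 0"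
        by simp
      from nn_integral_energy_tail[OF \<sigma> \<tau> S this, of n]
      show ?thesis
        using S[of "D g"] by (simp add: F1_def case_prod_unfold \<tau>_def)
    qed

    have I2: "(\<integral>\<^sup>+\<omega>. F2 y \<omega> \<partial>noise_law \<sigma>\<^sub>a \<sigma>\<^sub>z n m) \<le>
        ennreal ((1 / sqrt (1 + h)) ^ n * (1 / real m ^ card (K y)))" if y: "y \<in> Y" for y
    proof -
      note qy = q[OF y]
      have "(\<integral>\<^sup>+\<omega>. F2 y \<omega> \<partial>noise_law \<sigma>\<^sub>a \<sigma>\<^sub>z n m) = ennreal ((1 / sqrt (q y)) ^ n)"
        using nn_integral_energy_diff[of \<sigma>\<^sub>a \<sigma>\<^sub>z "l y" "\<lambda>j. x j - y j" "K y" m n] \<sigma> Yprops(4)[OF y] qy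
        by (simp add: F2_def case_prod_unfold)
      also have "\<dots> \<le> ennreal ((1 / sqrt (1 + h)) ^ n * (1 / real m ^ card (K y)))"
      proof (rule ennreal_leI)
        \<comment> \<open>The factor \<open>M ^ card (K y)\<close>, raised to the power
          \<open>n\<close>, outweighs \<open>m ^ card (K y)\<close>, the number of choices for the
          wrong positions, and still leaves \<open>sqrt (1 + h) ^ n\<close>.\<close>
        have "sqrt (1 + h) * M ^ card (K y) = sqrt ((1 + h) * M ^ (2 * card (K y)))"
          using M(1) h by (simp add: real_sqrt_mult power_mult[of M 2] mult.commute[of 2] power_mult)
        also have "\<dots> \<le> sqrt (q y)"
          using qy(1) by simp
        finally have "(sqrt (1 + h) * M ^ card (K y)) ^ n \<le> sqrt (q y) ^ n"
          using M(1) h by (intro power_mono) auto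
        moreover have "real m ^ card (K y) \<le> (M ^ n) ^ card (K y)"
          using M(2) by (intro power_mono) auto
        ultimately have "sqrt (1 + h) ^ n * real m ^ card (K y) \<le> sqrt (q y) ^ n"
          using h by (simp add: power_mult_distrib power_mult[symmetric] mult.commute[of n])
            (meson mult_left_mono order_trans real_sqrt_ge_zero zero_le_power add_nonneg_nonneg less_imp_le zero_le_one)
        then have "1 / sqrt (q y) ^ n \<le> 1 / (sqrt (1 + h) ^ n * real m ^ card (K y))"
          using m h qy(2) by (intro divide_left_mono) auto
        then show "(1 / sqrt (q y)) ^ n \<le> (1 / sqrt (1 + h)) ^ n * (1 / real m ^ card (K y))"
          by (simp add: power_divide)
      qed
      finally show ?thesis .
    qed

    have base: "chernoff_base (1 + h) ^ n \<ge> 0" "chernoff_base (1 - h) ^ n \<ge> 0"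
      using h chernoff_base_pos[of "1 + h"] chernoff_base_pos[of "1 - h"] by simp_all
    have "(\<integral>\<^sup>+\<omega>. F \<omega> \<partial>noise_law \<sigma>\<^sub>a \<sigma>\<^sub>z n m) = (\<integral>\<^sup>+\<omega>. F0 \<omega> \<partial>noise_law \<sigma>\<^sub>a \<sigma>\<^sub>z n m) +
      (\<Sum>g\<in>G. \<integral>\<^sup>+\<omega>. F1 g \<omega> \<partial>noise_law \<sigma>\<^sub>a \<sigma>\<^sub>z n m) + (\<Sum>y\<in>Y. \<integral>\<^sup>+\<omega>. F2 y \<omega> \<partial>noise_law \<sigma>\<^sub>a \<sigma>\<^sub>z n m)"
      unfolding F_def by (simp add: nn_integral_add nn_integral_sum)
    also have "\<dots> \<le> ennreal (chernoff_base (1 + h) ^ n) + (\<Sum>g\<in>G. ennreal (chernoff_base (1 - h) ^ n)) +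
        (\<Sum>y\<in>Y. ennreal ((1 / sqrt (1 + h)) ^ n * (1 / real m ^ card (K y))))"
      by (intro add_mono sum_mono I0 I1 I2)
    also have "\<dots> = ennreal (chernoff_base (1 + h) ^ n + (\<Sum>g\<in>G. chernoff_base (1 - h) ^ n) +
        (\<Sum>y\<in>Y. (1 / sqrt (1 + h)) ^ n * (1 / real m ^ card (K y))))"
      using base h by (subst sum_ennreal, simp, subst sum_ennreal, simp)
        (simp add: ennreal_plus[symmetric] sum_nonneg del: ennreal_plus sum_constant)
    also have "\<dots> \<le> ennreal (chernoff_base (1 + h) ^ n +
       (real (card Q) + 1) ^ k * chernoff_base (1 - h) ^ n +
       k * (real (card Q) + 1) ^ (2 * k) * (1 / sqrt (1 + h)) ^ n)"
    proof (intro ennreal_leI add_mono order_refl)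
      show "(\<Sum>g\<in>G. chernoff_base (1 - h) ^ n) \<le> (real (card Q) + 1) ^ k * chernoff_base (1 - h) ^ n"
        using cardG base by (simp add: mult_right_mono)
      have "(\<Sum>y\<in>Y. (1 / sqrt (1 + h)) ^ n * (1 / real m ^ card (K y))) =
          (1 / sqrt (1 + h)) ^ n * (\<Sum>y\<in>Y. 1 / real m ^ card (K y))"
        by (rule sum_distrib_left[symmetric])
      also have "\<dots> \<le> (1 / sqrt (1 + h)) ^ n * (k * (real (card Q) + 1) ^ (2 * k))"
        unfolding Y_def K_def using h
        by (intro mult_left_mono sum_sparse_signals_le Q X m) auto
      finally show "(\<Sum>y\<in>Y. (1 / sqrt (1 + h)) ^ n * (1 / real m ^ card (K y))) \<le>
          k * (real (card Q) + 1) ^ (2 * k) * (1 / sqrt (1 + h)) ^ n"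
        by (simp only: mult.commute)
    qed
    finally show "(\<integral>\<^sup>+\<omega>. F \<omega> \<partial>noise_law \<sigma>\<^sub>a \<sigma>\<^sub>z n m) \<le> ennreal (chernoff_base (1 + h) ^ n +
       (real (card Q) + 1) ^ k * chernoff_base (1 - h) ^ n +
       k * (real (card Q) + 1) ^ (2 * k) * (1 / sqrt (1 + h)) ^ n)" .
  qed
qed

text \<open>Odd multiples of \<open>1 / n\<close>, since \<open>0\<close> must not be a grid value.\<close>

definition grid :: "nat \<Rightarrow> nat \<Rightarrow> real set" where
  "grid B n = (\<lambda>i::int. (2 * of_int i + 1) / real n) ` {- int (B * n) - 1..int (B * n)}"

lemma finite_grid: "finite (grid B n)"
  by (simp add: grid_def)

lemma zero_notin_grid:
  assumes "n > 0"
  shows "0 \<notin> grid B n"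
proof
  assume "0 \<in> grid B n"
  then obtain i :: int where "(2 * of_int i + 1) / real n = 0"
    by (auto simp: grid_def)
  then have "2 * real_of_int i + 1 = 0"
    using assms by simp
  then have "2 * i + 1 = 0"
    by linarith
  then show False by presburger
qed

lemma card_grid_le: "real (card (grid B n)) \<le> 2 * real B * real n + 2"
proof -
  have "card (grid B n) \<le> card {- int (B * n) - 1..int (B * n)}"
    unfolding grid_def by (rule card_image_le) simp
  also have "\<dots> = 2 * B * n + 2"
    by (simp add: nat_eq_iff)
  finally have "real (card (grid B n)) \<le> real (2 * B * n + 2)"
    by (rule of_nat_mono)
  then show ?thesis by simp
qed

lemma grid_approx:
  assumes "n > 0" "\<bar>x\<bar> \<le> real B"
  obtains g where "g \<in> grid B n" "\<bar>x - g\<bar> \<le> 1 / real n"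
proof
  \<comment> \<open>\<open>x * n\<close> lies between \<open>2 * i\<close> and
    \<open>2 * i + 2\<close>; the odd number in the middle is within distance 1. The index range of
    the grid is wide enough to contain \<open>i\<close>.\<close>
  define i where "i = \<lfloor>x * n / 2\<rfloor>"
  have i: "of_int i \<le> x * n / 2" "x * n / 2 < of_int i + 1"
    by (simp_all add: i_def) linarith
  have xn: "\<bar>x * n\<bar> \<le> real B * n"
    using assms by (simp add: abs_mult mult_right_mono)
  have "real_of_int i \<le> of_int (int (B * n))" "of_int (- int (B * n) - 1) \<le> real_of_int i"
    using i xn by auto
  then have "i \<le> int (B * n)" "- int (B * n) - 1 \<le> i"
    by (simp_all only: of_int_le_iff)
  then show "(2 * of_int i + 1) / real n \<in> grid B n"
    unfolding grid_def by (intro image_eqI[of _ _ i]) auto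
  have "\<bar>x * n - (2 * of_int i + 1)\<bar> \<le> 1"
    using i by linarith
  then have "\<bar>x * n - (2 * of_int i + 1)\<bar> / real n \<le> 1 / real n"
    by (intro divide_right_mono) auto
  also have "\<bar>x * n - (2 * of_int i + 1)\<bar> / real n = \<bar>x - (2 * of_int i + 1) / real n\<bar>"
  proof -
    have "x - (2 * of_int i + 1) / real n = (x * n - (2 * of_int i + 1)) / real n"
      using assms(1) by (simp add: diff_divide_distrib)
    then show ?thesis by (simp only: abs_divide abs_of_nat)
  qed
  finally show "\<bar>x - (2 * of_int i + 1) / real n\<bar> \<le> 1 / real n" .
qed

section \<open>Signals built from values and positions\<close>

lemma distinct_tuplesD:
  assumes "s \<in> distinct_tuples k m"
  shows "inj_on s {1..k}" "s ` {1..k} \<subseteq> {1..m}"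
  using assms by (auto simp: distinct_tuples_def)

lemma finite_distinct_tuples: "finite (distinct_tuples k m)"
  unfolding distinct_tuples_def by (rule finite_subset[OF _ finite_PiE[of "{1..k}" "\<lambda>_. {1..m}"]]) auto

lemma distinct_tuples_nonempty:
  assumes "k \<le> m"
  shows "distinct_tuples k m \<noteq> {}"
proof -
  have "restrict id {1..k} \<in> distinct_tuples k m"
    using assms by (auto simp: distinct_tuples_def inj_on_def)
  then show ?thesis by blast
qed

lemma signal_apply:
  assumes "s \<in> distinct_tuples k m" "j \<in> {1..k}"
  shows "signal k w s (s j) = w j"
  using assms distinct_tuplesD(1)[OF assms(1)] by (auto simp: signal_def the_inv_into_f_f)

lemma signal_eq_0: "i \<notin> s ` {1..k} \<Longrightarrow> signal k w s i = 0"
  by (simp add: signal_def)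

lemma supp_signal:
  assumes "s \<in> distinct_tuples k m" "\<And>j. j \<in> {1..k} \<Longrightarrow> w j \<noteq> 0"
  shows "supp m (signal k w s) = s ` {1..k}"
proof
  show "supp m (signal k w s) \<subseteq> s ` {1..k}"
    unfolding supp_def using signal_eq_0 by blast
  have "signal k w s (s j) \<noteq> 0" if "j \<in> {1..k}" for j
    using signal_apply[OF assms(1) that] assms(2)[OF that] by metis
  then show "s ` {1..k} \<subseteq> supp m (signal k w s)"
    unfolding supp_def using distinct_tuplesD(2)[OF assms(1)] by blast
qed

text \<open>The bound of \<open>error_majorant\<close> with the grid size replaced by its linear
  estimate. It involves neither the positions \<open>s\<close> nor the dimension \<open>m\<close>,
  except through \<open>n\<close>.\<close>

definition error_bound :: "nat \<Rightarrow> nat \<Rightarrow> real \<Rightarrow> nat \<Rightarrow> real" where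
  "error_bound k B h n = chernoff_base (1 + h) ^ n +
     (2 * real B * real n + 3) ^ k * chernoff_base (1 - h) ^ n +
     k * (2 * real B * real n + 3) ^ (2 * k) * (1 / sqrt (1 + h)) ^ n"

text \<open>Rounding each \<open>w j\<close> to the grid preserves the support, because 0 is not a
  grid value. The conditions on the signal then become conditions on \<open>w\<close> alone, since
  \<open>s\<close> is injective and sums over positions reindex to sums over
  \<open>{1..k}\<close>.\<close>

lemma error_majorant_signal:
  fixes \<sigma>\<^sub>a \<sigma>\<^sub>z h M :: real and B n m k :: nat and w :: "nat \<Rightarrow> real"
  assumes \<sigma>: "\<sigma>\<^sub>a > 0" "\<sigma>\<^sub>z > 0" and n: "n > 0" and m: "m > 0"
    and s: "s \<in> distinct_tuples k m"
    and w: "\<And>j. j \<in> {1..k} \<Longrightarrow> w j \<noteq> 0" "\<And>j. j \<in> {1..k} \<Longrightarrow> \<bar>w j\<bar> \<le> real B"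
    and h: "0 < h" "h < 1" and M: "M \<ge> 1" "real m \<le> M ^ n"
    and near: "\<sigma>\<^sub>a\<^sup>2 * (k * (1 / real n)\<^sup>2) \<le> h * \<sigma>\<^sub>z\<^sup>2"
    and sep: "\<And>T. T \<subseteq> {1..k} \<Longrightarrow> T \<noteq> {} \<Longrightarrow>
      (1 + h) ^ 3 * \<sigma>\<^sub>z\<^sup>2 * M ^ (2 * card T) \<le> (1 - h) * (\<sigma>\<^sub>z\<^sup>2 + \<sigma>\<^sub>a\<^sup>2 * (\<Sum>j\<in>T. (w j)\<^sup>2))"
  obtains F where "F \<in> borel_measurable (noise_law \<sigma>\<^sub>a \<sigma>\<^sub>z n m)"
    "\<And>A z. least_squares_support n m k (grid B n) (measurement n m A (signal k w s) z, A) \<noteq>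
      supp m (signal k w s) \<Longrightarrow> (1::ennreal) \<le> F (A, z)"
    "(\<integral>\<^sup>+\<omega>. F \<omega> \<partial>noise_law \<sigma>\<^sub>a \<sigma>\<^sub>z n m) \<le> ennreal (error_bound k B h n)"
proof -
  note inj = distinct_tuplesD(1)[OF s] and range = distinct_tuplesD(2)[OF s]
  have "\<exists>g. g \<in> grid B n \<and> \<bar>w j - g\<bar> \<le> 1 / real n" if "j \<in> {1..k}" for j
    using grid_approx[OF n w(2)[OF that]] by blast
  then obtain w' where w': "\<And>j. j \<in> {1..k} \<Longrightarrow> w' j \<in> grid B n"
      "\<And>j. j \<in> {1..k} \<Longrightarrow> \<bar>w j - w' j\<bar> \<le> 1 / real n"
    by metis
  have w'0: "w' j \<noteq> 0" if "j \<in> {1..k}" for j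
    using w'(1)[OF that] zero_notin_grid[OF n] by metis
  \<comment> \<open>The restriction makes the quantized signal extensional, as candidates
    are.\<close>
  let ?x = "signal k w s" and ?x' = "restrict (signal k w' s) {1..m}"
  have supp_x: "supp m ?x = s ` {1..k}"
    using supp_signal[OF s] w by blast
  have "supp m ?x' = supp m (signal k w' s)"
    by (auto simp: supp_def)
  also have "\<dots> = s ` {1..k}"
    using supp_signal[OF s] w'0 by blast
  finally have supp_x': "supp m ?x' = s ` {1..k}" .
  have "signal k w' s i \<in> insert 0 (grid B n)" for i
    using w'(1) signal_apply[OF s, of _ w'] signal_eq_0[of i s k w'] by (cases "i \<in> s ` {1..k}") auto
  then have x': "?x' \<in> sparse_signals m k (grid B n)"
    using inj supp_x' by (auto simp: sparse_signals_def card_image)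
  have "(\<Sum>i\<in>{1..m}. (?x i - ?x' i)\<^sup>2) = (\<Sum>i\<in>s ` {1..k}. (signal k w s i - signal k w' s i)\<^sup>2)"
    using range by (intro sum.mono_neutral_cong_right) (auto simp: signal_eq_0)
  also have "\<dots> = (\<Sum>j\<in>{1..k}. (w j - w' j)\<^sup>2)"
    unfolding sum.reindex[OF inj] by (intro sum.cong) (auto simp: signal_apply[OF s])
  also have "\<dots> \<le> (\<Sum>j\<in>{1..k}. (1 / real n)\<^sup>2)"
    using w'(2) by (intro sum_mono power2_le_iff_abs_le[THEN iffD2]) auto
  finally have "(\<Sum>i\<in>{1..m}. (?x i - ?x' i)\<^sup>2) \<le> k * (1 / real n)\<^sup>2"
    by simp
  then have "\<sigma>\<^sub>a\<^sup>2 * (\<Sum>i\<in>{1..m}. (?x i - ?x' i)\<^sup>2) \<le> \<sigma>\<^sub>a\<^sup>2 * (k * (1 / real n)\<^sup>2)"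
    by (rule mult_left_mono) simp
  then have near': "\<sigma>\<^sub>a\<^sup>2 * (\<Sum>i\<in>{1..m}. (?x i - ?x' i)\<^sup>2) \<le> h * \<sigma>\<^sub>z\<^sup>2"
    using near by linarith
  have sep': "(1 + h) ^ 3 * \<sigma>\<^sub>z\<^sup>2 * M ^ (2 * card D) \<le> (1 - h) * (\<sigma>\<^sub>z\<^sup>2 + \<sigma>\<^sub>a\<^sup>2 * (\<Sum>i\<in>D. (?x i)\<^sup>2))"
    if D: "D \<subseteq> supp m ?x" "D \<noteq> {}" for D
  proof -
    obtain T where T: "T \<subseteq> {1..k}" "D = s ` T"
      using D(1) unfolding supp_x by (meson subset_imageE)
    have injT: "inj_on s T"
      using inj T(1) inj_on_subset by blast
    have "(\<Sum>i\<in>D. (?x i)\<^sup>2) = (\<Sum>j\<in>T. (w j)\<^sup>2)"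
      unfolding T(2) sum.reindex[OF injT] using T(1) signal_apply[OF s] by (intro sum.cong) auto
    moreover have "card D = card T"
      using T(2) injT card_image by blast
    moreover have "T \<noteq> {}"
      using T D by blast
    ultimately show ?thesis
      using sep[OF T(1)] by simp
  qed
  have nonneg: "chernoff_base (1 - h) ^ n \<ge> 0" "(1 / sqrt (1 + h)) ^ n \<ge> 0"
    using h chernoff_base_pos[of "1 - h"] by simp_all
  obtain F where F: "F \<in> borel_measurable (noise_law \<sigma>\<^sub>a \<sigma>\<^sub>z n m)"
    "\<And>A z. least_squares_support n m k (grid B n) (measurement n m A ?x z, A) \<noteq> supp m ?x \<Longrightarrow> (1::ennreal) \<le> F (A, z)"
    "(\<integral>\<^sup>+\<omega>. F \<omega> \<partial>noise_law \<sigma>\<^sub>a \<sigma>\<^sub>z n m) \<le> ennreal (chernoff_base (1 + h) ^ n +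
       (real (card (grid B n)) + 1) ^ k * chernoff_base (1 - h) ^ n +
       k * (real (card (grid B n)) + 1) ^ (2 * k) * (1 / sqrt (1 + h)) ^ n)"
    using error_majorant[OF \<sigma> finite_grid zero_notin_grid[OF n] m x' _ h M near' sep'] supp_x supp_x'
    by metis
  have "real (card (grid B n)) + 1 \<le> 2 * real B * real n + 3"
    using card_grid_le[of B n] by simp
  then have pow: "(real (card (grid B n)) + 1) ^ p \<le> (2 * real B * real n + 3) ^ p" for p
    by (rule power_mono) simp
  have "chernoff_base (1 + h) ^ n +
       (real (card (grid B n)) + 1) ^ k * chernoff_base (1 - h) ^ n +
       k * (real (card (grid B n)) + 1) ^ (2 * k) * (1 / sqrt (1 + h)) ^ n \<le> error_bound k B h n"
    unfolding error_bound_def using nonneg by (intro add_mono mult_right_mono mult_left_mono pow order_refl) auto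
  then show ?thesis
    using that[OF F(1,2)] F(3) ennreal_leI order_trans by meson
qed

text \<open>The law of the positions is a finite average of point masses, so a bound valid for every
  fixed tuple survives averaging. Each tuple may have its own majorant.\<close>

lemma emeasure_le_of_slices:
  fixes e :: ennreal
  assumes \<sigma>: "\<sigma>\<^sub>a > 0" "\<sigma>\<^sub>z > 0" and km: "k \<le> m"
    and E: "E \<in> sets (gaussian_matrix \<sigma>\<^sub>a n m \<Otimes>\<^sub>M uniform_count_measure (distinct_tuples k m) \<Otimes>\<^sub>M
      gaussian_vector \<sigma>\<^sub>z n)"
    and F: "\<And>s. s \<in> distinct_tuples k m \<Longrightarrow> F s \<in> borel_measurable (noise_law \<sigma>\<^sub>a \<sigma>\<^sub>z n m)"
    and EF: "\<And>s A z. s \<in> distinct_tuples k m \<Longrightarrow> (A, s, z) \<in> E \<Longrightarrow> 1 \<le> F s (A, z)"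
    and Fe: "\<And>s. s \<in> distinct_tuples k m \<Longrightarrow> (\<integral>\<^sup>+\<omega>. F s \<omega> \<partial>noise_law \<sigma>\<^sub>a \<sigma>\<^sub>z n m) \<le> e"
  shows "emeasure (gaussian_matrix \<sigma>\<^sub>a n m \<Otimes>\<^sub>M uniform_count_measure (distinct_tuples k m) \<Otimes>\<^sub>M
      gaussian_vector \<sigma>\<^sub>z n) E \<le> e"
proof -
  let ?T = "distinct_tuples k m"
  let ?MS = "uniform_count_measure ?T" and ?MA = "gaussian_matrix \<sigma>\<^sub>a n m" and ?MZ = "gaussian_vector \<sigma>\<^sub>z n"
  let ?P = "?MA \<Otimes>\<^sub>M ?MS \<Otimes>\<^sub>M ?MZ"
  have T: "finite ?T" "?T \<noteq> {}"
    using finite_distinct_tuples distinct_tuples_nonempty[OF km] by auto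
  interpret Z: prob_space ?MZ using \<sigma> by (intro prob_space_gaussian_vector)
  interpret S: prob_space ?MS by (rule prob_space_uniform_count_measure[OF T])
  interpret SZ: prob_space "?MS \<Otimes>\<^sub>M ?MZ"
    by (intro prob_space_pair S.prob_space_axioms Z.prob_space_axioms)
  note F[measurable]
  have ind[measurable]: "(indicator {s} :: _ \<Rightarrow> ennreal) \<in> borel_measurable ?MS" if "s \<in> ?T" for s
    using that by (intro borel_measurable_indicator) (simp add: sets_uniform_count_measure)
  have slice: "(\<integral>\<^sup>+(A, t, z). indicator {s} t * F s (A, z) \<partial>?P) = ennreal (1 / card ?T) * (\<integral>\<^sup>+\<omega>. F s \<omega> \<partial>noise_law \<sigma>\<^sub>a \<sigma>\<^sub>z n m)"
    and meas: "(\<lambda>(A, t, z). indicator {s} t * F s (A, z)) \<in> borel_measurable ?P" if s: "s \<in> ?T" for s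
  proof -
    note [measurable] = F[OF s] ind[OF s]
    show m: "(\<lambda>(A, t, z). indicator {s} t * F s (A, z)) \<in> borel_measurable ?P"
      by measurable
    have "(\<integral>\<^sup>+(A, t, z). indicator {s} t * F s (A, z) \<partial>?P) =
      (\<integral>\<^sup>+A. \<integral>\<^sup>+t. \<integral>\<^sup>+z. indicator {s} t * F s (A, z) \<partial>?MZ \<partial>?MS \<partial>?MA)"
      unfolding SZ.nn_integral_fst[OF m, symmetric]
    proof (intro nn_integral_cong, goal_cases)
      case (1 A)
      then have "(\<lambda>(t, z). indicator {s} t * F s (A, z)) \<in> borel_measurable (?MS \<Otimes>\<^sub>M ?MZ)"
        by measurable
      from Z.nn_integral_fst[OF this] show ?case
        by simp
    qed
    also have "\<dots> = (\<integral>\<^sup>+A. \<integral>\<^sup>+t. indicator {s} t * (\<integral>\<^sup>+z. F s (A, z) \<partial>?MZ) \<partial>?MS \<partial>?MA)"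
      by (intro nn_integral_cong nn_integral_cmult) measurable
    also have "\<dots> = (\<integral>\<^sup>+A. ennreal (1 / card ?T) * (\<integral>\<^sup>+z. F s (A, z) \<partial>?MZ) \<partial>?MA)"
    proof (intro nn_integral_cong)
      fix A
      have "(\<integral>\<^sup>+t. indicator {s} t * (\<integral>\<^sup>+z. F s (A, z) \<partial>?MZ) \<partial>?MS) =
        emeasure ?MS {s} * (\<integral>\<^sup>+z. F s (A, z) \<partial>?MZ)"
        using s by (subst nn_integral_multc) (auto simp: sets_uniform_count_measure)
      then show "(\<integral>\<^sup>+t. indicator {s} t * (\<integral>\<^sup>+z. F s (A, z) \<partial>?MZ) \<partial>?MS) =
        ennreal (1 / card ?T) * (\<integral>\<^sup>+z. F s (A, z) \<partial>?MZ)"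
        using s T by (simp add: emeasure_uniform_count_measure)
    qed
    also have "\<dots> = ennreal (1 / card ?T) * (\<integral>\<^sup>+A. \<integral>\<^sup>+z. F s (A, z) \<partial>?MZ \<partial>?MA)"
      by (intro nn_integral_cmult) measurable
    finally show "(\<integral>\<^sup>+(A, t, z). indicator {s} t * F s (A, z) \<partial>?P) =
        ennreal (1 / card ?T) * (\<integral>\<^sup>+\<omega>. F s \<omega> \<partial>noise_law \<sigma>\<^sub>a \<sigma>\<^sub>z n m)"
      by (simp add: Z.nn_integral_fst)
  qed
  have "emeasure ?P E = (\<integral>\<^sup>+\<omega>. indicator E \<omega> \<partial>?P)"
    using E by simp
  \<comment> \<open>The sum over tuples selects the majorant of the tuple that was drawn.\<close>
  also have "\<dots> \<le> (\<integral>\<^sup>+\<omega>. (\<Sum>s\<in>?T. case \<omega> of (A, t, z) \<Rightarrow> indicator {s} t * F s (A, z)) \<partial>?P)"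
  proof (intro nn_integral_mono)
    fix \<omega> assume \<omega>: "\<omega> \<in> space ?P"
    obtain A t z where eq: "\<omega> = (A, t, z)" by (metis surj_pair)
    have t: "t \<in> ?T"
      using \<omega> by (simp add: eq space_pair_measure space_uniform_count_measure)
    show "indicator E \<omega> \<le> (\<Sum>s\<in>?T. case \<omega> of (A, t, z) \<Rightarrow> indicator {s} t * F s (A, z))"
    proof (cases "\<omega> \<in> E")
      case True
      then have "indicator E \<omega> \<le> indicator {t} t * F t (A, z)"
        using EF[OF t] eq by simp
      also have "\<dots> \<le> (\<Sum>s\<in>?T. indicator {s} t * F s (A, z))"
        using member_le_sum[OF t, of "\<lambda>s. indicator {s} t * F s (A, z)"] T(1) by simp
      finally show ?thesis by (simp add: eq)
    qed simp
  qed
  also have "\<dots> = (\<Sum>s\<in>?T. ennreal (1 / card ?T) * (\<integral>\<^sup>+\<omega>. F s \<omega> \<partial>noise_law \<sigma>\<^sub>a \<sigma>\<^sub>z n m))"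
    using meas slice by (subst nn_integral_sum) simp_all
  also have "\<dots> \<le> (\<Sum>s\<in>?T. ennreal (1 / card ?T) * e)"
    by (intro sum_mono mult_left_mono Fe) auto
  also have "\<dots> = (ennreal (card ?T) * ennreal (1 / card ?T)) * e"
    by (simp add: mult.assoc ennreal_of_nat_eq_real_of_nat)
  also have "ennreal (card ?T) * ennreal (1 / card ?T) = 1"
    using T by (simp add: ennreal_mult[symmetric])
  finally show ?thesis by simp
qed

section \<open>Asymptotics\<close>

text \<open>At \<open>h = 0\<close> the inequalities are strict. By continuity each persists for
  small \<open>h\<close>, and finitely many of them share one \<open>h\<close>.\<close>

lemma exists_margin:
  fixes a S :: "'t \<Rightarrow> real"
  assumes "finite \<T>" "\<And>T. T \<in> \<T> \<Longrightarrow> a T < S T"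
  obtains h where "0 < h" "h < 1" "\<And>T. T \<in> \<T> \<Longrightarrow> (1 + h) ^ 3 * a T \<le> (1 - h) * S T"
proof -
  have "\<forall>\<^sub>F h in at_right 0. (1 + h) ^ 3 * a T < (1 - h) * S T" if "T \<in> \<T>" for T
  proof -
    have "((\<lambda>h. (1 - h) * S T - (1 + h) ^ 3 * a T) \<longlongrightarrow> (1 - 0) * S T - (1 + 0) ^ 3 * a T) (at_right (0::real))"
      by (intro tendsto_intros)
    then have "\<forall>\<^sub>F h in at_right 0. 0 < (1 - h) * S T - (1 + h) ^ 3 * a T"
      by (rule order_tendstoD) (use assms(2)[OF that] in simp)
    then show ?thesis by simp
  qed
  then have "\<forall>\<^sub>F h in at_right 0. \<forall>T\<in>\<T>. (1 + h) ^ 3 * a T < (1 - h) * S T"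
    by (intro eventually_ball_finite assms(1)) auto
  moreover have "\<forall>\<^sub>F h in at_right (0::real). h \<in> {0<..<1}"
    by (rule eventually_at_right_real) simp
  ultimately have "\<forall>\<^sub>F h in at_right 0. h \<in> {0<..<1} \<and> (\<forall>T\<in>\<T>. (1 + h) ^ 3 * a T < (1 - h) * S T)"
    by (rule eventually_conj[rotated])
  then obtain h :: real where "h \<in> {0<..<1}" "\<forall>T\<in>\<T>. (1 + h) ^ 3 * a T < (1 - h) * S T"
    using eventually_happens' trivial_limit_at_right_real by blast
  then show ?thesis
    using that[of h] by (auto intro: less_imp_le)
qed

section \<open>The capacity as a minimum over sets of missed positions\<close>

lemma capacity_le:
  assumes "T \<subseteq> {1..k}" "T \<noteq> {}"
  shows "capacity b k \<sigma>\<^sub>a \<sigma>\<^sub>z w \<le> 1 / (2 * real (card T)) * log b (1 + \<sigma>\<^sub>a\<^sup>2 / \<sigma>\<^sub>z\<^sup>2 * (\<Sum>j\<in>T. (w j)\<^sup>2))"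
  unfolding capacity_def using assms by (intro Min_le) auto

text \<open>Exponentiating each term of the minimum gives, with \<open>b powr c\<close> as
  \<open>M\<close>, the separation condition of the error bound before the slack \<open>h\<close> is
  introduced.\<close>

lemma less_capacityD:
  assumes "b > 1" "\<sigma>\<^sub>z > 0" "T \<subseteq> {1..k}" "T \<noteq> {}" "c < capacity b k \<sigma>\<^sub>a \<sigma>\<^sub>z w"
  shows "\<sigma>\<^sub>z\<^sup>2 * (b powr c) ^ (2 * card T) < \<sigma>\<^sub>z\<^sup>2 + \<sigma>\<^sub>a\<^sup>2 * (\<Sum>j\<in>T. (w j)\<^sup>2)"
proof -
  let ?v = "1 + \<sigma>\<^sub>a\<^sup>2 / \<sigma>\<^sub>z\<^sup>2 * (\<Sum>j\<in>T. (w j)\<^sup>2)"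
  have v: "?v > 0"
    by (intro add_pos_nonneg mult_nonneg_nonneg sum_nonneg) auto
  have "finite T"
    using assms(3) finite_subset by blast
  then have t: "real (card T) > 0"
    using assms(4) by (simp add: card_gt_0_iff)
  have "c < 1 / (2 * real (card T)) * log b ?v"
    using capacity_le[OF assms(3,4)] assms(5) less_le_trans by blast
  then have "c * (2 * real (card T)) < log b ?v"
    using t by (simp add: field_simps)
  then have "b powr (c * (2 * real (card T))) < ?v"
    using v assms(1) by (simp add: less_log_iff)
  also have "b powr (c * (2 * real (card T))) = (b powr c) ^ (2 * card T)"
    using assms(1) powr_realpow[of "b powr c" "2 * card T"] by (simp add: powr_powr)
  finally have "\<sigma>\<^sub>z\<^sup>2 * (b powr c) ^ (2 * card T) < \<sigma>\<^sub>z\<^sup>2 * ?v"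
    using assms(2) by simp
  also have "\<dots> = \<sigma>\<^sub>z\<^sup>2 + \<sigma>\<^sub>a\<^sup>2 * (\<Sum>j\<in>T. (w j)\<^sup>2)"
    using assms(2) by (simp add: field_simps)
  finally show ?thesis .
qed

text \<open>Positivity leaves room for a positive rate \<open>c\<close> below the capacity.\<close>

lemma capacity_pos:
  assumes "b > 1" "k \<ge> 1" "\<sigma>\<^sub>a > 0" "\<sigma>\<^sub>z > 0" "\<And>j. j \<in> {1..k} \<Longrightarrow> w j \<noteq> 0"
  shows "capacity b k \<sigma>\<^sub>a \<sigma>\<^sub>z w > 0"
proof -
  have "{T. T \<noteq> {} \<and> T \<subseteq> {1..k}} \<noteq> {}"
    using assms(2) by (auto intro!: exI[of _ "{1..k}"])
  moreover have "1 / (2 * real (card T)) * log b (1 + \<sigma>\<^sub>a\<^sup>2 / \<sigma>\<^sub>z\<^sup>2 * (\<Sum>j\<in>T. (w j)\<^sup>2)) > 0"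
    if T: "T \<noteq> {}" "T \<subseteq> {1..k}" for T
  proof -
    have fin: "finite T"
      using T finite_subset by blast
    have "(\<Sum>j\<in>T. (w j)\<^sup>2) > 0"
      using T fin assms(5) by (intro sum_pos) auto
    then have "log b (1 + \<sigma>\<^sub>a\<^sup>2 / \<sigma>\<^sub>z\<^sup>2 * (\<Sum>j\<in>T. (w j)\<^sup>2)) > 0"
      using assms(1,3,4) by (subst zero_less_log_cancel_iff) (auto intro: add_pos_nonneg)
    moreover have "card T > 0"
      using T fin by (simp add: card_gt_0_iff)
    ultimately show ?thesis by simp
  qed
  ultimately show ?thesis
    unfolding capacity_def by (subst Min_gr_iff) auto
qed

lemma borel_measurable_capacity:
  assumes "sets \<mu> = sets (\<Pi>\<^sub>M j\<in>{1..k}. (borel :: real measure))"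
  shows "capacity b k \<sigma>\<^sub>a \<sigma>\<^sub>z \<in> borel_measurable \<mu>"
proof -
  have "(\<lambda>w. w j) \<in> borel_measurable \<mu>" if "j \<in> {1..k}" for j
    unfolding measurable_cong_sets[OF assms refl] using that by (rule measurable_component_singleton)
  then show ?thesis
    unfolding capacity_def[abs_def]
    by (intro borel_measurable_Min borel_measurable_times borel_measurable_log borel_measurable_add
        borel_measurable_sum borel_measurable_power measurable_const UNIV_I) auto
qed

section \<open>Limits as the number of measurements grows\<close>

lemma linear_power_times_power_tendsto_0:
  fixes C x :: real
  assumes "0 < x" "x < 1" "C > 0"
  shows "(\<lambda>n. (C * real n + 3) ^ p * x ^ n) \<longlonglongrightarrow> 0"
  using assms by real_asymp

lemma error_bound_tendsto_0:
  assumes "0 < h" "h < 1" "B > 0"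
  shows "error_bound k B h \<longlonglongrightarrow> 0"
proof -
  have x: "0 < chernoff_base (1 + h)" "chernoff_base (1 + h) < 1"
    "0 < chernoff_base (1 - h)" "chernoff_base (1 - h) < 1"
    "0 < 1 / sqrt (1 + h)" "1 / sqrt (1 + h) < 1"
    using assms chernoff_base_pos chernoff_base_less_1 by auto
  have "(\<lambda>n. chernoff_base (1 + h) ^ n +
     (2 * real B * real n + 3) ^ k * chernoff_base (1 - h) ^ n +
     k * ((2 * real B * real n + 3) ^ (2 * k) * (1 / sqrt (1 + h)) ^ n)) \<longlonglongrightarrow> 0 + 0 + real k * 0"
    using x assms(3) by (intro tendsto_intros linear_power_times_power_tendsto_0 LIMSEQ_realpow_zero) auto
  then show ?thesis
    by (simp add: error_bound_def[abs_def] mult.assoc)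
qed

text \<open>A rate below \<open>c\<close> forces \<open>n m\<close> above
  \<open>log b m / c\<close>, which diverges.\<close>

lemma block_length_tendsto_infinity:
  fixes n :: "nat \<Rightarrow> nat"
  assumes "b > 1" "c > 0" "\<forall>\<^sub>F m in sequentially. log b (real m) / real (n m) < c"
    and "\<forall>\<^sub>F m in sequentially. n m > 0"
  shows "filterlim n at_top sequentially"
proof -
  have "filterlim (\<lambda>m. log b (real m) / c) at_top sequentially"
    using assms(1,2) by real_asymp
  moreover have "\<forall>\<^sub>F m in sequentially. log b (real m) / c \<le> real (n m)"
    using assms(3,4) by eventually_elim (use assms(2) in \<open>simp add: field_simps\<close>)
  ultimately have "filterlim (\<lambda>m. real (n m)) at_top sequentially"
    by (rule filterlim_at_top_mono)
  then show ?thesis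
    by (simp add: filterlim_sequentially_iff_filterlim_real)
qed

text \<open>The case of a fixed \<open>w\<close> whose capacity exceeds \<open>r\<close>. The
  quantities \<open>c\<close>, \<open>M\<close> and \<open>h\<close> of the proof depend on
  \<open>w\<close>, but the decoder depends only on \<open>B\<close> and the dimensions.
  \<open>E m\<close> may be any measurable part of the error event.\<close>

lemma error_section_tendsto_0:
  fixes n :: "nat \<Rightarrow> nat" and E :: "nat \<Rightarrow> ((nat \<times> nat \<Rightarrow> real) \<times> (nat \<Rightarrow> nat) \<times> (nat \<Rightarrow> real)) set"
  assumes b: "b > 1" and k: "k \<ge> 1" and \<sigma>: "\<sigma>\<^sub>a > 0" "\<sigma>\<^sub>z > 0"
    and B: "B > 0"
    and w: "\<And>j. j \<in> {1..k} \<Longrightarrow> w j \<noteq> 0" "\<And>j. j \<in> {1..k} \<Longrightarrow> \<bar>w j\<bar> \<le> real B"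
    and n: "\<And>m. m \<ge> k \<Longrightarrow> n m > 0"
    and r: "limsup (\<lambda>m. ereal (log b (real m) / real (n m))) = r" "r < ereal (capacity b k \<sigma>\<^sub>a \<sigma>\<^sub>z w)"
    and E: "\<And>m. E m \<in> sets (gaussian_matrix \<sigma>\<^sub>a (n m) m \<Otimes>\<^sub>M uniform_count_measure (distinct_tuples k m) \<Otimes>\<^sub>M
      gaussian_vector \<sigma>\<^sub>z (n m))"
    and err: "\<And>m A s z. (A, s, z) \<in> E m \<Longrightarrow> least_squares_support (n m) m k (grid B (n m))
      (measurement (n m) m A (signal k w s) z, A) \<noteq> supp m (signal k w s)"
  shows "(\<lambda>m. emeasure (gaussian_matrix \<sigma>\<^sub>a (n m) m \<Otimes>\<^sub>M uniform_count_measure (distinct_tuples k m) \<Otimes>\<^sub>M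
      gaussian_vector \<sigma>\<^sub>z (n m)) (E m)) \<longlonglongrightarrow> 0"
proof -
  let ?S = "\<lambda>T. \<sigma>\<^sub>z\<^sup>2 + \<sigma>\<^sub>a\<^sup>2 * (\<Sum>j\<in>T. (w j)\<^sup>2)"
  \<comment> \<open>The maximum with 0 makes \<open>c\<close> positive, which yields
    \<open>M \<ge> 1\<close> and diverging block lengths.\<close>
  have "max r 0 < ereal (capacity b k \<sigma>\<^sub>a \<sigma>\<^sub>z w)"
    using r(2) capacity_pos[where b = b and k = k and \<sigma>\<^sub>a = \<sigma>\<^sub>a and \<sigma>\<^sub>z = \<sigma>\<^sub>z and w = w, OF b k \<sigma> w(1)]
    by simp
  then obtain c where c: "max r 0 < ereal c" "ereal c < ereal (capacity b k \<sigma>\<^sub>a \<sigma>\<^sub>z w)"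
    using ereal_dense2 by blast
  then have c0: "c > 0" and rc: "r < ereal c" and cap: "c < capacity b k \<sigma>\<^sub>a \<sigma>\<^sub>z w"
    by auto
  \<comment> \<open>With this \<open>M\<close> the rate condition reads \<open>m < M ^ n\<close>,
    and \<open>c\<close> being below the capacity becomes the separation condition.\<close>
  define M where "M = b powr c"
  have M: "M \<ge> 1"
    using b c0 by (simp add: M_def ge_one_powr_ge_zero)
  obtain h where h: "0 < h" "h < 1" and
    sep: "\<And>T. T \<in> {T. T \<noteq> {} \<and> T \<subseteq> {1..k}} \<Longrightarrow> (1 + h) ^ 3 * (\<sigma>\<^sub>z\<^sup>2 * M ^ (2 * card T)) \<le> (1 - h) * ?S T"
    using exists_margin[of "{T. T \<noteq> {} \<and> T \<subseteq> {1..k}}" "\<lambda>T. \<sigma>\<^sub>z\<^sup>2 * M ^ (2 * card T)" ?S]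
      less_capacityD[OF b \<sigma>(2) _ _ cap] unfolding M_def by auto
  have rate: "\<forall>\<^sub>F m in sequentially. log b (real m) / real (n m) < c"
    using Limsup_lessD[of sequentially "\<lambda>m. ereal (log b (real m) / real (n m))" "ereal c"] r(1) rc by simp
  have mk: "\<forall>\<^sub>F m in sequentially. m \<ge> k"
    by (rule eventually_ge_at_top)
  have n_lim: "filterlim n at_top sequentially"
    by (rule block_length_tendsto_infinity[OF b c0 rate eventually_mono[OF mk n]])
  have "(\<lambda>n. \<sigma>\<^sub>a\<^sup>2 * (real k * (1 / real n)\<^sup>2)) \<longlonglongrightarrow> \<sigma>\<^sub>a\<^sup>2 * (real k * 0\<^sup>2)"
    by (intro tendsto_intros lim_1_over_n)
  then have "\<forall>\<^sub>F n in sequentially. \<sigma>\<^sub>a\<^sup>2 * (real k * (1 / real n)\<^sup>2) < h * \<sigma>\<^sub>z\<^sup>2"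
    using h \<sigma> by (intro order_tendstoD(2)[of _ 0]) auto
  then have near: "\<forall>\<^sub>F m in sequentially. \<sigma>\<^sub>a\<^sup>2 * (real k * (1 / real (n m))\<^sup>2) < h * \<sigma>\<^sub>z\<^sup>2"
    by (rule eventually_compose_filterlim[OF _ n_lim])
  have upper: "\<forall>\<^sub>F m in sequentially. emeasure (gaussian_matrix \<sigma>\<^sub>a (n m) m \<Otimes>\<^sub>M
      uniform_count_measure (distinct_tuples k m) \<Otimes>\<^sub>M gaussian_vector \<sigma>\<^sub>z (n m)) (E m)
      \<le> ennreal (error_bound k B h (n m))"
    using rate mk near
  proof eventually_elim
    case (elim m)
    have m: "m > 0" and nm: "n m > 0"
      using elim k n by auto
    have "log b (real m) < c * real (n m)"
      using elim(1) nm by (simp add: field_simps)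
    then have "real m < b powr (c * real (n m))"
      using b m by (simp add: log_less_iff)
    also have "\<dots> = M ^ n m"
      using b powr_realpow[of M "n m"] by (simp add: M_def powr_powr)
    finally have mM: "real m \<le> M ^ n m"
      by simp
    have near': "\<sigma>\<^sub>a\<^sup>2 * (real k * (1 / real (n m))\<^sup>2) \<le> h * \<sigma>\<^sub>z\<^sup>2"
      using elim(3) by simp
    have sep': "(1 + h) ^ 3 * \<sigma>\<^sub>z\<^sup>2 * M ^ (2 * card T) \<le> (1 - h) * ?S T"
      if "T \<subseteq> {1..k}" "T \<noteq> {}" for T
      using sep[of T] that by (simp add: mult.assoc)
    define good where "good = (\<lambda>s F. F \<in> borel_measurable (noise_law \<sigma>\<^sub>a \<sigma>\<^sub>z (n m) m) \<and>
      (\<forall>A z. (A, s, z) \<in> E m \<longrightarrow> (1::ennreal) \<le> F (A, z)) \<and>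
      (\<integral>\<^sup>+\<omega>. F \<omega> \<partial>noise_law \<sigma>\<^sub>a \<sigma>\<^sub>z (n m) m) \<le> ennreal (error_bound k B h (n m)))"
    have "\<exists>F. good s F" if s: "s \<in> distinct_tuples k m" for s
    proof (rule error_majorant_signal[OF \<sigma> nm m s w h M mM near' sep'])
      fix F :: "(nat \<times> nat \<Rightarrow> real) \<times> (nat \<Rightarrow> real) \<Rightarrow> ennreal"
      assume F: "F \<in> borel_measurable (noise_law \<sigma>\<^sub>a \<sigma>\<^sub>z (n m) m)"
        "\<And>A z. least_squares_support (n m) m k (grid B (n m)) (measurement (n m) m A (signal k w s) z, A) \<noteq>
          supp m (signal k w s) \<Longrightarrow> 1 \<le> F (A, z)"
        "(\<integral>\<^sup>+\<omega>. F \<omega> \<partial>noise_law \<sigma>\<^sub>a \<sigma>\<^sub>z (n m) m) \<le> ennreal (error_bound k B h (n m))"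
      have "good s F"
        unfolding good_def using F(1,3) F(2)[OF err] by simp
      then show ?thesis by (rule exI[of _ F])
    qed
    then have "\<forall>s\<in>distinct_tuples k m. \<exists>F. good s F"
      by (rule ballI)
    from bchoice[OF this] obtain F where "\<forall>s\<in>distinct_tuples k m. good s (F s)"
      by (rule exE)
    note F = bspec[OF this]
    show ?case
    proof (rule emeasure_le_of_slices[OF \<sigma> elim(2) E])
      fix s assume s: "s \<in> distinct_tuples k m"
      show "F s \<in> borel_measurable (noise_law \<sigma>\<^sub>a \<sigma>\<^sub>z (n m) m)"
        "(\<integral>\<^sup>+\<omega>. F s \<omega> \<partial>noise_law \<sigma>\<^sub>a \<sigma>\<^sub>z (n m) m) \<le> ennreal (error_bound k B h (n m))"
        using F[OF s] by (simp_all only: good_def)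
      show "1 \<le> F s (A, z)" if "(A, s, z) \<in> E m" for A z
        using F[OF s] that by (simp only: good_def)
    qed
  qed
  have zero: "(\<lambda>m. ennreal (error_bound k B h (n m))) \<longlonglongrightarrow> 0"
    using tendsto_ennrealI[OF filterlim_compose[OF error_bound_tendsto_0[OF h B] n_lim]] by simp
  show ?thesis
    by (rule tendsto_sandwich[OF _ upper tendsto_const zero]) simp
qed

section \<open>Averaging over the law of W\<close>

lemma prob_space_joint_law:
  assumes "prob_space \<mu>" "\<sigma>\<^sub>a > 0" "\<sigma>\<^sub>z > 0" "k \<le> m"
  shows "prob_space (joint_law k m n \<mu> \<sigma>\<^sub>a \<sigma>\<^sub>z)"
  unfolding joint_law_def using assms
  by (intro prob_space_pair prob_space_gaussian_matrix prob_space_gaussian_vector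
      prob_space_uniform_count_measure finite_distinct_tuples distinct_tuples_nonempty)

theorem theorem5:
  fixes b \<sigma>\<^sub>a \<sigma>\<^sub>z :: real and k :: nat and n :: "nat \<Rightarrow> nat" and r :: ereal
    and \<mu> :: "(nat \<Rightarrow> real) measure"
  assumes "b > 1" and "k \<ge> 1" and "\<sigma>\<^sub>a > 0" and "\<sigma>\<^sub>z > 0"
    and "prob_space \<mu>" and "sets \<mu> = sets (\<Pi>\<^sub>M j\<in>{1..k}. (borel :: real measure))"
    and "AE w in \<mu>. \<forall>j\<in>{1..k}. w j \<noteq> 0"
    and "\<exists>B. AE w in \<mu>. \<forall>j\<in>{1..k}. \<bar>w j\<bar> \<le> B"
    and "\<And>m. m \<ge> k \<Longrightarrow> n m > 0"
    and "limsup (\<lambda>m. ereal (log b (real m) / real (n m))) = r"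
  shows "\<exists>d. (\<forall>m\<ge>k. d m \<in> recovery_maps (n m) m) \<and>
    limsup (\<lambda>m. ereal (\<P>((w, A, s, z) in joint_law k m (n m) \<mu> \<sigma>\<^sub>a \<sigma>\<^sub>z.
        d m (measurement (n m) m A (signal k w s) z, A) \<noteq> supp m (signal k w s))))
    \<le> ereal (\<P>(w in \<mu>. ereal (capacity b k \<sigma>\<^sub>a \<sigma>\<^sub>z w) \<le> r))"
proof -
  interpret \<mu>: prob_space \<mu> by fact
  obtain B0 where B0: "AE w in \<mu>. \<forall>j\<in>{1..k}. \<bar>w j\<bar> \<le> B0"
    using assms(8) by blast
  \<comment> \<open>\<open>B\<close> depends on the law of \<open>W\<close> but not on its
    realization. The added 1 makes it positive.\<close>
  define B where "B = nat \<lceil>B0\<rceil> + 1"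
  have B: "B > 0" "B0 \<le> real B"
    using real_nat_ceiling_ge[of B0] by (simp_all add: B_def)
  define d where "d = (\<lambda>m. least_squares_support (n m) m k (grid B (n m)))"
  define J where "J = (\<lambda>m. joint_law k m (n m) \<mu> \<sigma>\<^sub>a \<sigma>\<^sub>z)"
  define N where "N = (\<lambda>m. gaussian_matrix \<sigma>\<^sub>a (n m) m \<Otimes>\<^sub>M uniform_count_measure (distinct_tuples k m) \<Otimes>\<^sub>M
    gaussian_vector \<sigma>\<^sub>z (n m))"
  define Err where "Err = (\<lambda>m. {(w, A, s, z) \<in> space (J m).
    d m (measurement (n m) m A (signal k w s) z, A) \<noteq> supp m (signal k w s)})"
  define bad where "bad = {w \<in> space \<mu>. ereal (capacity b k \<sigma>\<^sub>a \<sigma>\<^sub>z w) \<le> r}"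
  have J: "J m = \<mu> \<Otimes>\<^sub>M N m" for m
    by (simp add: J_def N_def joint_law_def)
  have rec: "d m \<in> recovery_maps (n m) m" for m
    unfolding d_def by (intro least_squares_support_in_recovery_maps finite_grid)
  have probJ: "prob_space (J m)" if "m \<ge> k" for m
    unfolding J_def using prob_space_joint_law assms(3,4,5) that by blast
  have probN: "prob_space (N m)" if "m \<ge> k" for m
    unfolding N_def using assms(3,4) that
    by (intro prob_space_pair prob_space_gaussian_matrix prob_space_gaussian_vector
      prob_space_uniform_count_measure finite_distinct_tuples distinct_tuples_nonempty)
  have cap_meas: "capacity b k \<sigma>\<^sub>a \<sigma>\<^sub>z \<in> borel_measurable \<mu>"
    by (rule borel_measurable_capacity) fact
  then have bad: "bad \<in> sets \<mu>"
    unfolding bad_def by measurable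

  \<comment> \<open>Proving the error event measurable is not necessary: otherwise its measure is \<open>0\<close> by convention.\<close>
  define E where "E = (\<lambda>m. if m \<ge> k \<and> Err m \<in> sets (J m) then Err m else {})"
  \<comment> \<open>For \<open>m \<ge> k\<close> this is the conditional probability of
    \<open>E m\<close> given \<open>W = w\<close>.\<close>
  define u where "u = (\<lambda>m w. emeasure (N m) (Pair w -` E m))"
  have E: "E m \<in> sets (\<mu> \<Otimes>\<^sub>M N m)" for m
    by (simp add: E_def J)
  have ErrE: "measure (J m) (Err m) = measure (J m) (E m)" if "m \<ge> k" for m
    using that by (simp add: E_def measure_notin_sets)
  have Err_int: "emeasure (J m) (E m) = (\<integral>\<^sup>+w. u m w \<partial>\<mu>)" and u_meas: "u m \<in> borel_measurable \<mu>"
    and u_le: "u m w \<le> 1" for m w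
  proof -
    have "emeasure (J m) (E m) = (\<integral>\<^sup>+w. u m w \<partial>\<mu>) \<and> u m \<in> borel_measurable \<mu> \<and> u m w \<le> 1"
    proof (cases "m \<ge> k")
      case True
      interpret N: prob_space "N m" by (rule probN[OF True])
      show ?thesis
        unfolding u_def J using N.emeasure_pair_measure_alt[OF E] N.measurable_emeasure_Pair[OF E]
          N.emeasure_le_1 by simp
    next
      \<comment> \<open>For \<open>m < k\<close> there are no distinct tuples, so \<open>N m\<close>
        is not a probability measure; the choice \<open>E m = {}\<close> lets the three facts hold
        for every \<open>m\<close>.\<close>
      case False
      then have "E m = {}" "u m = (\<lambda>_. 0)"
        by (simp_all add: E_def u_def)
      then show ?thesis by simp
    qed
    then show "emeasure (J m) (E m) = (\<integral>\<^sup>+w. u m w \<partial>\<mu>)" "u m \<in> borel_measurable \<mu>" "u m w \<le> 1"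
      by auto
  qed
  have u_lim: "AE w in \<mu>. (\<lambda>m. u m w * indicator (space \<mu> - bad) w) \<longlonglongrightarrow> 0"
    using assms(7) B0 AE_space
  proof eventually_elim
    case (elim w)
    show ?case
    proof (cases "w \<in> bad")
      case False
      then have cap: "r < ereal (capacity b k \<sigma>\<^sub>a \<sigma>\<^sub>z w)"
        using elim by (auto simp: bad_def not_le)
      have "(\<lambda>m. u m w) \<longlonglongrightarrow> 0"
        unfolding u_def N_def
      proof (rule error_section_tendsto_0[OF assms(1-4) B(1) _ _ assms(9,10) cap])
        fix j assume "j \<in> {1..k}"
        then show "w j \<noteq> 0" "\<bar>w j\<bar> \<le> real B"
          using elim(1,2) B(2) order_trans by blast+
      next
        fix m
        show "Pair w -` E m \<in> sets (gaussian_matrix \<sigma>\<^sub>a (n m) m \<Otimes>\<^sub>M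
            uniform_count_measure (distinct_tuples k m) \<Otimes>\<^sub>M gaussian_vector \<sigma>\<^sub>z (n m))"
          using sets_Pair1[OF E] unfolding N_def .
      next
        fix m A s z assume "(A, s, z) \<in> Pair w -` E m"
        then show "least_squares_support (n m) m k (grid B (n m))
            (measurement (n m) m A (signal k w s) z, A) \<noteq> supp m (signal k w s)"
          by (simp add: E_def Err_def d_def split: if_splits)
      qed
      then show ?thesis
        using False elim(3) by simp
    qed simp
  qed
  \<comment> \<open>The speed of convergence may depend on \<open>w\<close>; the constant 1
    dominates.\<close>
  have "(\<lambda>m. \<integral>\<^sup>+w. u m w * indicator (space \<mu> - bad) w \<partial>\<mu>) \<longlonglongrightarrow> (\<integral>\<^sup>+w. 0 \<partial>\<mu>)"
  proof (rule nn_integral_dominated_convergence[where w = "\<lambda>_. 1"])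
    show "(\<lambda>w. u m w * indicator (space \<mu> - bad) w) \<in> borel_measurable \<mu>" for m
      using u_meas[measurable] bad[measurable] by measurable
    show "AE w in \<mu>. u m w * indicator (space \<mu> - bad) w \<le> 1" for m
      using u_le by (auto simp: indicator_def)
  qed (use u_lim in \<open>simp_all add: \<mu>.emeasure_space_1\<close>)
  then have lim: "(\<lambda>m. emeasure \<mu> bad + (\<integral>\<^sup>+w. u m w * indicator (space \<mu> - bad) w \<partial>\<mu>)) \<longlonglongrightarrow> emeasure \<mu> bad + 0"
    by (intro tendsto_add tendsto_const) simp
  \<comment> \<open>On \<open>bad\<close> the conditional error probability is estimated by 1, which
    produces the right-hand side of the theorem.\<close>
  have le: "emeasure (J m) (E m) \<le> emeasure \<mu> bad + (\<integral>\<^sup>+w. u m w * indicator (space \<mu> - bad) w \<partial>\<mu>)" for m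
  proof -
    have "(\<integral>\<^sup>+w. u m w \<partial>\<mu>) \<le> (\<integral>\<^sup>+w. indicator bad w + u m w * indicator (space \<mu> - bad) w \<partial>\<mu>)"
      using u_le by (intro nn_integral_mono) (auto simp: indicator_def)
    also have "\<dots> = (\<integral>\<^sup>+w. indicator bad w \<partial>\<mu>) + (\<integral>\<^sup>+w. u m w * indicator (space \<mu> - bad) w \<partial>\<mu>)"
      using u_meas[measurable] bad[measurable] by (intro nn_integral_add) measurable
    finally show ?thesis
      using bad by (simp add: Err_int)
  qed
  have "limsup (\<lambda>m. ereal (measure (J m) (Err m))) \<le>
    limsup (\<lambda>m. enn2ereal (emeasure \<mu> bad + (\<integral>\<^sup>+w. u m w * indicator (space \<mu> - bad) w \<partial>\<mu>)))"
  proof (rule Limsup_mono)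
    show "\<forall>\<^sub>F m in sequentially. ereal (measure (J m) (Err m)) \<le>
      enn2ereal (emeasure \<mu> bad + (\<integral>\<^sup>+w. u m w * indicator (space \<mu> - bad) w \<partial>\<mu>))"
      using eventually_ge_at_top[of k]
    proof eventually_elim
      case (elim m)
      interpret J: prob_space "J m" by (rule probJ[OF elim])
      have "ereal (measure (J m) (Err m)) = enn2ereal (emeasure (J m) (E m))"
        by (simp add: ErrE[OF elim] J.emeasure_eq_measure)
      also have "\<dots> \<le> enn2ereal (emeasure \<mu> bad + (\<integral>\<^sup>+w. u m w * indicator (space \<mu> - bad) w \<partial>\<mu>))"
        using le[of m] by (simp only: less_eq_ennreal.rep_eq)
      finally show ?case .
    qed
  qed
  also have "\<dots> = enn2ereal (emeasure \<mu> bad + 0)"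
    by (intro lim_imp_Limsup tendsto_enn2erealI lim) simp
  also have "\<dots> = ereal (measure \<mu> bad)"
    by (simp add: \<mu>.emeasure_eq_measure)
  finally have "limsup (\<lambda>m. ereal (measure (J m) (Err m))) \<le> ereal (measure \<mu> bad)" .
  then show ?thesis
    unfolding bad_def Err_def J_def by (intro exI[of _ d] conjI allI impI rec)
qed

end
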